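(* Consider the instrumental variable model (indexed by the sample size $n$) and the one-sided statistic $LM_1$ described in the context. Define $$c(\Delta,\mu)=\frac{\Delta\mu'\Sigma_{11}^{-1}\mu-\Delta^2\mu'\Sigma_{11}^{-1}\Sigma_{21}\Sigma_{11}^{-1}\mu}{\left(\mu'(I_k-\Delta\Sigma_{11}^{-1}\Sigma_{12})\Sigma_{11}^{-1}(I_k-\Delta\Sigma_{21}\Sigma_{11}^{-1})\mu\right)^{1/2}}.$$ Suppose Assumption NA holds, $\Delta=\beta^*-\beta_0$ is fixed, and $\pi$ is a fixed nonzero $k$-vector. Then, as $n\to\infty$, $$LM_1-c(\Delta,\mu)\to_d N\left(0,\;1+\|\gamma\|^{-2}\Delta^2\,\pi'D^{1/2}\Sigma_{11}^{-1/2}M_\gamma\Sigma_{11}^{-1/2}(\Sigma^{22})^{-1}\Sigma_{11}^{-1/2}M_\gamma\Sigma_{11}^{-1/2}D^{1/2}\pi\right),$$ where $$\gamma=\Sigma_{11}^{-1/2}(I_k-\Delta\Sigma_{21}\Sigma_{11}^{-1})D^{1/2}\pi,\qquad M_\gamma=I_k-\frac{\gamma\gamma'}{\|\gamma\|^2}.$$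
   Context: Model. For each $n$, $Z$ is a nonrandom $n\times k$ matrix of full column rank, and $Y=Z\pi a^{*\prime}+V$ with $a^*=(\beta^*,1)'$ and $V$ a random mean-zero $n\times2$ matrix of reduced-form errors (dependence on $n$ suppressed). Put $R=(Z'Z)^{-1/2}Z'Y=\mu a^{*\prime}+(Z'Z)^{-1/2}Z'V$ with $\mu=(Z'Z)^{1/2}\pi$. Matrix square roots are symmetric. Assumption NA: (a) $n^{-1}Z'Z\to D$, $D$ positive definite; (b) $n^{-1}V'V\to_p\Omega$, $\Omega$ positive definite; (c) $\mathrm{vec}((Z'Z)^{-1/2}Z'V)\to_d N(0,\Sigma)$ with $\Sigma\in\mathbb{R}^{2k\times2k}$ positive definite. $\Sigma$ is treated as known. Notation. $\beta_0\in\mathbb{R}$ is the fixed hypothesized value, $a_0=(\beta_0,1)'$, $b_0=(1,-\beta_0)'$, $B_0=\begin{pmatrix}1&0\\-\beta_0&1\end{pmatrix}$, $\Sigma_0=(B_0'\otimes I_k)\Sigma(B_0\otimes I_k)=\begin{pmatrix}\Sigma_{11}&\Sigma_{12}\\ \Sigma_{21}&\Sigma_{22}\end{pmatrix}$ ($k\times k$ blocks), $\Sigma^{22}=(\Sigma_{22}-\Sigma_{21}\Sigma_{11}^{-1}\Sigma_{12})^{-1}$. Statistics: $T=[(a_0'\otimes I_k)\Sigma^{-1}(a_0\otimes I_k)]^{-1/2}(a_0'\otimes I_k)\Sigma^{-1}\mathrm{vec}(R)$, $S=[(b_0'\otimes I_k)\Sigma(b_0\otimes I_k)]^{-1/2}(b_0'\otimes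 I_k)\mathrm{vec}(R)$, $$LM_1=\frac{S'\Sigma_{11}^{-1/2}(\Sigma^{22})^{-1/2}T}{\left\|\Sigma_{11}^{-1/2}(\Sigma^{22})^{-1/2}T\right\|}.$$
   Formalization: The formal theorem additionally assumes γ ≠ 0; when γ = 0 (possible for nonzero π if 1/Δ is an eigenvalue of Σ₂₁Σ₁₁⁻¹) the limit variance and M_γ in the statement are undefined. *)

theory Defs
  imports "HOL-Probability.Probability"
begin

definition pos_semidef :: "real^'n^'n \<Rightarrow> bool" where
  "pos_semidef A \<longleftrightarrow> transpose A = A \<and> (\<forall>x. 0 \<le> x \<bullet> (A *v x))"

definition pos_def :: "real^'n^'n \<Rightarrow> bool" where
  "pos_def A \<longleftrightarrow> transpose A = A \<and> (\<forall>x. x \<noteq> 0 \<longrightarrow> 0 < x \<bullet> (A *v x))"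

text \<open>The symmetric (principal) square root. For positive semidefinite \<open>A\<close> there is exactly one
  such \<open>B\<close>; the value is irrelevant for other \<open>A\<close>.\<close>

definition msqrt :: "real^'n^'n \<Rightarrow> real^'n^'n" where
  "msqrt A = (THE B. pos_semidef B \<and> B ** B = A)"

definition inv_msqrt :: "real^'n^'n \<Rightarrow> real^'n^'n" where
  "inv_msqrt A = matrix_inv (msqrt A)"

text \<open>A matrix with \<open>n\<close> rows, \<open>n\<close> being a natural number, is given by its sequence of rows, of which
  only those with index below \<open>n\<close> matter. \<open>crossprod n A B\<close> is the product \<open>A'B\<close>.\<close>

definition crossprod :: "nat \<Rightarrow> (nat \<Rightarrow> real^'p) \<Rightarrow> (nat \<Rightarrow> real^'q) \<Rightarrow> real^'q^'p" where
  "crossprod n A B = (\<chi> j l. \<Sum>i<n. A i $ j * B i $ l)"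

text \<open>Linear independence of the columns; the \<open>i\<close>-th entry of \<open>Z c\<close> is \<open>Z i \<bullet> c\<close>.\<close>

definition full_column_rank :: "nat \<Rightarrow> (nat \<Rightarrow> real^'k) \<Rightarrow> bool" where
  "full_column_rank n Z \<longleftrightarrow> (\<forall>c. (\<forall>i<n. Z i \<bullet> c = 0) \<longrightarrow> c = 0)"

text \<open>The index set of a vector with 2 blocks of length \<open>k\<close> is the product of the index types, the
  first component numbering the block. Thus \<open>vec\<close> stacks columns, and the Kronecker product has its
  usual block structure.\<close>

definition vec_cols :: "real^2^'k \<Rightarrow> real^(2 \<times> 'k::finite)" where
  "vec_cols A = (\<chi> p. A $ snd p $ fst p)"

definition kron :: "real^'b^'a \<Rightarrow> real^'d^'c \<Rightarrow> real^('b::finite \<times> 'd::finite)^('a::finite \<times> 'c::finite)" where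
  "kron A B = (\<chi> p q. A $ fst p $ fst q * B $ snd p $ snd q)"

text \<open>\<open>a' \<otimes> I\<^sub>k\<close> for a vector \<open>a\<close>; its transpose is \<open>a \<otimes> I\<^sub>k\<close>.\<close>

definition row_kron_id :: "real^2 \<Rightarrow> real^(2 \<times> 'k::finite)^'k" where
  "row_kron_id a = (\<chi> i q. a $ fst q * mat 1 $ i $ snd q)"

definition block :: "2 \<Rightarrow> 2 \<Rightarrow> real^(2 \<times> 'k::finite)^(2 \<times> 'k) \<Rightarrow> real^'k^'k" where
  "block r s A = (\<chi> i j. A $ (r, i) $ (s, j))"

definition tendsto_in_prob ::
    "(nat \<Rightarrow> 'a measure) \<Rightarrow> (nat \<Rightarrow> 'a \<Rightarrow> 'b::metric_space) \<Rightarrow> 'b \<Rightarrow> bool" where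
  "tendsto_in_prob M X c \<longleftrightarrow>
     (\<forall>\<epsilon>>0. (\<lambda>n. measure (M n) {\<omega> \<in> space (M n). dist (X n \<omega>) c > \<epsilon>}) \<longlonglongrightarrow> 0)"

text \<open>Weak convergence of Borel probability measures, needed here on Euclidean spaces of
  dimension greater than one, to which \<open>weak_conv_m\<close> does not apply.\<close>

definition weakly_converges ::
    "(nat \<Rightarrow> 'b::topological_space measure) \<Rightarrow> 'b measure \<Rightarrow> bool" where
  "weakly_converges N L \<longleftrightarrow>
     (\<forall>f :: 'b \<Rightarrow> real. continuous_on UNIV f \<longrightarrow> bounded (range f) \<longrightarrow>
        (\<lambda>n. \<integral>x. f x \<partial>N n) \<longlonglongrightarrow> (\<integral>x. f x \<partial>L))"

definition multivariate_normal :: "real^'n \<Rightarrow> real^'n^'n \<Rightarrow> (real^'n) measure" where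
  "multivariate_normal m A = density lborel (\<lambda>x. ennreal
     (exp (- ((x - m) \<bullet> (matrix_inv A *v (x - m))) / 2) / sqrt ((2 * pi) ^ CARD('n) * det A)))"

text \<open>The second parameter is the variance, whereas \<open>normal_density\<close> takes the standard
  deviation.\<close>

definition normal_law :: "real \<Rightarrow> real \<Rightarrow> real measure" where
  "normal_law m v = density lborel (\<lambda>x. ennreal (normal_density m (sqrt v) x))"

definition a0_vec :: "real \<Rightarrow> real^2" where
  "a0_vec \<beta>\<^sub>0 = vector [\<beta>\<^sub>0, 1]"

definition b0_vec :: "real \<Rightarrow> real^2" where
  "b0_vec \<beta>\<^sub>0 = vector [1, - \<beta>\<^sub>0]"

definition B0_mat :: "real \<Rightarrow> real^2^2" where
  "B0_mat \<beta>\<^sub>0 = vector [vector [1, 0], vector [- \<beta>\<^sub>0, 1]]"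

definition Sigma0 :: "real \<Rightarrow> real^(2 \<times> 'k::finite)^(2 \<times> 'k) \<Rightarrow> real^(2 \<times> 'k)^(2 \<times> 'k)" where
  "Sigma0 \<beta>\<^sub>0 \<Sigma> = kron (transpose (B0_mat \<beta>\<^sub>0)) (mat 1) ** \<Sigma> ** kron (B0_mat \<beta>\<^sub>0) (mat 1)"

definition Sigma_block :: "2 \<Rightarrow> 2 \<Rightarrow> real \<Rightarrow> real^(2 \<times> 'k::finite)^(2 \<times> 'k) \<Rightarrow> real^'k^'k" where
  "Sigma_block r s \<beta>\<^sub>0 \<Sigma> = block r s (Sigma0 \<beta>\<^sub>0 \<Sigma>)"

text \<open>\<open>\<Sigma>\<^sup>2\<^sup>2\<close> (upper indices), not to be confused with the block \<open>\<Sigma>\<^sub>2\<^sub>2\<close>, which is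
  \<open>Sigma_block 2 2\<close>.\<close>

definition Sigma_sup22 :: "real \<Rightarrow> real^(2 \<times> 'k::finite)^(2 \<times> 'k) \<Rightarrow> real^'k^'k" where
  "Sigma_sup22 \<beta>\<^sub>0 \<Sigma> = matrix_inv (Sigma_block 2 2 \<beta>\<^sub>0 \<Sigma> -
     Sigma_block 2 1 \<beta>\<^sub>0 \<Sigma> ** matrix_inv (Sigma_block 1 1 \<beta>\<^sub>0 \<Sigma>) ** Sigma_block 1 2 \<beta>\<^sub>0 \<Sigma>)"

definition R_stat :: "nat \<Rightarrow> (nat \<Rightarrow> real^'k) \<Rightarrow> (nat \<Rightarrow> real^2) \<Rightarrow> real^2^'k" where
  "R_stat n Z Y = inv_msqrt (crossprod n Z Z) ** crossprod n Z Y"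

definition S_stat :: "real \<Rightarrow> real^(2 \<times> 'k::finite)^(2 \<times> 'k) \<Rightarrow> real^2^'k \<Rightarrow> real^'k" where
  "S_stat \<beta>\<^sub>0 \<Sigma> R =
     inv_msqrt (row_kron_id (b0_vec \<beta>\<^sub>0) ** \<Sigma> ** transpose (row_kron_id (b0_vec \<beta>\<^sub>0))) *v
       (row_kron_id (b0_vec \<beta>\<^sub>0) *v vec_cols R)"

definition T_stat :: "real \<Rightarrow> real^(2 \<times> 'k::finite)^(2 \<times> 'k) \<Rightarrow> real^2^'k \<Rightarrow> real^'k" where
  "T_stat \<beta>\<^sub>0 \<Sigma> R =
     inv_msqrt (row_kron_id (a0_vec \<beta>\<^sub>0) ** matrix_inv \<Sigma> ** transpose (row_kron_id (a0_vec \<beta>\<^sub>0))) *v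
       ((row_kron_id (a0_vec \<beta>\<^sub>0) ** matrix_inv \<Sigma>) *v vec_cols R)"

definition LM1_stat :: "real \<Rightarrow> real^(2 \<times> 'k::finite)^(2 \<times> 'k) \<Rightarrow> real^2^'k \<Rightarrow> real" where
  "LM1_stat \<beta>\<^sub>0 \<Sigma> R =
     (let W = (inv_msqrt (Sigma_block 1 1 \<beta>\<^sub>0 \<Sigma>) ** inv_msqrt (Sigma_sup22 \<beta>\<^sub>0 \<Sigma>)) *v T_stat \<beta>\<^sub>0 \<Sigma> R
      in (S_stat \<beta>\<^sub>0 \<Sigma> R \<bullet> W) / norm W)"

definition c_shift :: "real \<Rightarrow> real^(2 \<times> 'k::finite)^(2 \<times> 'k) \<Rightarrow> real \<Rightarrow> real^'k \<Rightarrow> real" where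
  "c_shift \<beta>\<^sub>0 \<Sigma> \<Delta> \<mu> =
     (let \<Sigma>12 = Sigma_block 1 2 \<beta>\<^sub>0 \<Sigma>; \<Sigma>21 = Sigma_block 2 1 \<beta>\<^sub>0 \<Sigma>;
          \<Sigma>11inv = matrix_inv (Sigma_block 1 1 \<beta>\<^sub>0 \<Sigma>)
      in (\<Delta> * (\<mu> \<bullet> (\<Sigma>11inv *v \<mu>)) - \<Delta>\<^sup>2 * (\<mu> \<bullet> ((\<Sigma>11inv ** \<Sigma>21 ** \<Sigma>11inv) *v \<mu>))) /
         sqrt (\<mu> \<bullet> (((mat 1 - \<Delta> *\<^sub>R (\<Sigma>11inv ** \<Sigma>12)) ** \<Sigma>11inv **
                     (mat 1 - \<Delta> *\<^sub>R (\<Sigma>21 ** \<Sigma>11inv))) *v \<mu>)))"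

definition gamma_vec ::
    "real \<Rightarrow> real^(2 \<times> 'k::finite)^(2 \<times> 'k) \<Rightarrow> real^'k^'k \<Rightarrow> real \<Rightarrow> real^'k \<Rightarrow> real^'k" where
  "gamma_vec \<beta>\<^sub>0 \<Sigma> D \<Delta> \<pi> =
     (inv_msqrt (Sigma_block 1 1 \<beta>\<^sub>0 \<Sigma>) **
      (mat 1 - \<Delta> *\<^sub>R (Sigma_block 2 1 \<beta>\<^sub>0 \<Sigma> ** matrix_inv (Sigma_block 1 1 \<beta>\<^sub>0 \<Sigma>))) **
      msqrt D) *v \<pi>"

definition annihilator :: "real^'k \<Rightarrow> real^'k^'k" where
  "annihilator g = mat 1 - (1 / (norm g)\<^sup>2) *\<^sub>R ((columnvector g :: real^1^'k) ** rowvector g)"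

definition limit_variance ::
    "real \<Rightarrow> real^(2 \<times> 'k::finite)^(2 \<times> 'k) \<Rightarrow> real^'k^'k \<Rightarrow> real \<Rightarrow> real^'k \<Rightarrow> real" where
  "limit_variance \<beta>\<^sub>0 \<Sigma> D \<Delta> \<pi> =
     (let \<gamma> = gamma_vec \<beta>\<^sub>0 \<Sigma> D \<Delta> \<pi>; Q = inv_msqrt (Sigma_block 1 1 \<beta>\<^sub>0 \<Sigma>)
      in 1 + \<Delta>\<^sup>2 / (norm \<gamma>)\<^sup>2 *
           (\<pi> \<bullet> ((msqrt D ** Q ** annihilator \<gamma> ** Q ** matrix_inv (Sigma_sup22 \<beta>\<^sub>0 \<Sigma>) **
                  Q ** annihilator \<gamma> ** Q ** msqrt D) *v \<pi>)))"

end

theory Submission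
  imports Defs
begin

text \<open>Let \<open>Q = \<Sigma>\<^sub>1\<^sub>1\<^sup>-\<^sup>1\<^sup>/\<^sup>2\<close>, let \<open>U\<close> and \<open>U\<^sub>2\<close> be the two blocks of the errors transformed by \<open>B\<^sub>0\<close>,
  and let \<open>\<xi> = U\<^sub>2 - \<Sigma>\<^sub>2\<^sub>1\<Sigma>\<^sub>1\<^sub>1\<^sup>-\<^sup>1U\<close>, which is uncorrelated with \<open>U\<close> and has variance the inverse of
  \<open>\<Sigma>\<^sup>2\<^sup>2\<close>. Block inversion gives \<open>S = Q(\<Delta>\<mu> + U)\<close>, and \<open>LM\<^sub>1 = S'W / \<parallel>W\<parallel>\<close> with \<open>W = g + Q\<xi>\<close>,
  \<open>g = Q(I - \<Delta>\<Sigma>\<^sub>2\<^sub>1\<Sigma>\<^sub>1\<^sub>1\<^sup>-\<^sup>1)\<mu>\<close>, while \<open>c(\<Delta>,\<mu>) = \<Delta>(Q\<mu>)'g / \<parallel>g\<parallel>\<close>. Both \<open>\<mu>\<close> and \<open>g\<close> grow like \<open>\<surd>n\<close>,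
  and \<open>g/\<surd>n\<close> tends to \<open>\<gamma>\<close>, so the difference \<open>LM\<^sub>1 - c(\<Delta>,\<mu>)\<close> is a function of the errors that
  converges continuously to a linear functional, the second term of which is the derivative of
  \<open>x \<mapsto> x / \<parallel>x\<parallel>\<close> at \<open>\<gamma>\<close>. Together with tightness this transfers the weak convergence of the
  errors, and a linear functional of a Gaussian vector is Gaussian.\<close>

section \<open>Square roots of positive definite matrices\<close>

lemma inner_matrix_vector: "x \<bullet> (A *v y) = (transpose A *v x) \<bullet> y"
  for A :: "real^'n^'m"
  by (simp add: dot_lmul_matrix)

lemma inner_symmetric_matrix: "transpose A = A \<Longrightarrow> x \<bullet> (A *v y) = y \<bullet> (A *v x)"
  for A :: "real^'n^'n"
  by (metis inner_commute inner_matrix_vector)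

text \<open>Near zero the linear term dominates the quadratic one and changes sign with
  \<open>t\<close>. This is the first-order condition used by the variational arguments that
  follow.\<close>

lemma linear_coefficient_zero:
  fixes a b :: real
  assumes "\<And>t. 0 \<le> t * a + t\<^sup>2 * b"
  shows "a = 0"
proof (rule ccontr)
  assume a: "a \<noteq> 0"
  \<comment> \<open>The sign is opposite to that of \<open>a\<close>, and
    \<open>\<bar>t\<bar> * \<bar>b\<bar> < \<bar>a\<bar>\<close>, so the linear term wins.\<close>
  define t where "t = - a / (\<bar>b\<bar> + 1)"
  have "t * a + t\<^sup>2 * b \<le> t * a + t\<^sup>2 * \<bar>b\<bar>"
    by (simp add: mult_left_mono)
  also have "\<dots> = - (a\<^sup>2 / (\<bar>b\<bar> + 1)\<^sup>2)"
    unfolding t_def by (simp add: divide_simps power2_eq_square) (simp add: algebra_simps)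
  also have "\<dots> < 0"
    using a by (simp add: zero_less_divide_iff)
  finally show False
    using assms[of t] by linarith
qed

text \<open>Moving from \<open>v\<close> to \<open>v + t *\<^sub>R y\<close> keeps the form
  nonnegative, and the form vanishes at \<open>t = 0\<close>, so the coefficient of \<open>t\<close>
  must be zero. The subspace is there for \<open>rayleigh_maximum\<close>, where the sign of the
  form is known on \<open>S\<close> only.\<close>

lemma semidefinite_null_vector:
  fixes A :: "real^'n^'n"
  assumes sym: "transpose A = A" and S: "subspace S"
    and psd: "\<And>x. x \<in> S \<Longrightarrow> 0 \<le> x \<bullet> (A *v x)"
    and v: "v \<in> S" "v \<bullet> (A *v v) = 0" and y: "y \<in> S"
  shows "y \<bullet> (A *v v) = 0"
proof -
  have "0 \<le> t * (2 * (y \<bullet> (A *v v))) + t\<^sup>2 * (y \<bullet> (A *v y))" for t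
  proof -
    have "v + t *\<^sub>R y \<in> S"
      using S v y by (simp add: subspace_add subspace_scale)
    then have "0 \<le> (v + t *\<^sub>R y) \<bullet> (A *v (v + t *\<^sub>R y))"
      by (rule psd)
    also have "\<dots> = t * (2 * (y \<bullet> (A *v v))) + t\<^sup>2 * (y \<bullet> (A *v y))"
      using inner_symmetric_matrix[OF sym, of v y] v
      by (simp add: matrix_vector_right_distrib matrix_vector_mult_scaleR inner_add
          power2_eq_square algebra_simps)
    finally show ?thesis .
  qed
  then show ?thesis
    using linear_coefficient_zero by force
qed

text \<open>A maximizer of the quadratic form on the unit sphere of \<open>S\<close> is an
  eigenvector, because \<open>l I - A\<close> is semidefinite on \<open>S\<close> and its form
  vanishes at the maximizer. This stands in for the spectral theorem throughout.\<close>

lemma rayleigh_maximum: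
  fixes A :: "real^'n^'n"
  assumes sym: "transpose A = A" and S: "subspace S" "S \<noteq> {0}"
    and inv: "\<And>x. x \<in> S \<Longrightarrow> A *v x \<in> S"
  obtains v l where "v \<in> S" "norm v = 1" "A *v v = l *\<^sub>R v"
    "\<And>x. x \<in> S \<Longrightarrow> x \<bullet> (A *v x) \<le> l * (x \<bullet> x)"
proof -
  let ?K = "S \<inter> sphere 0 1"
  obtain w where w: "w \<in> S" "w \<noteq> 0"
    using S subspace_0 by blast
  have "compact ?K"
    using S by (simp add: closed_Int_compact closed_subspace)
  moreover have "w /\<^sub>R norm w \<in> ?K"
    using S w by (simp add: subspace_scale)
  moreover have "continuous_on ?K (\<lambda>x. x \<bullet> (A *v x))"
    by (intro continuous_intros)
  ultimately obtain v where v: "v \<in> ?K" and max: "\<And>x. x \<in> ?K \<Longrightarrow> x \<bullet> (A *v x) \<le> v \<bullet> (A *v v)"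
    using continuous_attains_sup[of ?K "\<lambda>x. x \<bullet> (A *v x)"] by blast
  define l where "l = v \<bullet> (A *v v)"
  have vv: "v \<bullet> v = 1"
    using v by (simp add: norm_eq_1)
  have le: "x \<bullet> (A *v x) \<le> l * (x \<bullet> x)" if "x \<in> S" for x
  proof (cases "x = 0")
    case False
    have "(x /\<^sub>R norm x) \<bullet> (A *v (x /\<^sub>R norm x)) \<le> l"
      unfolding l_def using S that False by (intro max) (simp add: subspace_scale)
    then show ?thesis
      using False by (simp add: matrix_vector_mult_scaleR dot_square_norm power2_eq_square field_simps)
  qed simp
  define N where "N = l *\<^sub>R mat 1 - A"
  have N: "N *v x = l *\<^sub>R x - A *v x" for x
    by (simp add: N_def matrix_vector_mult_diff_rdistrib flip: scaleR_matrix_vector_assoc)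
  have "y \<bullet> (N *v v) = 0" if "y \<in> S" for y
  proof (rule semidefinite_null_vector[OF _ \<open>subspace S\<close> _ _ _ that])
    show "transpose N = N"
      using sym by (simp add: N_def transpose_def vec_eq_iff mat_def)
    show "0 \<le> x \<bullet> (N *v x)" if "x \<in> S" for x
      using le[OF that] by (simp add: N inner_diff_right)
    show "v \<bullet> (N *v v) = 0"
      by (simp add: N inner_diff_right vv l_def)
  qed (use v in simp)
  moreover have "N *v v \<in> S"
    using v inv S by (simp add: N subspace_diff subspace_scale)
  \<comment> \<open>\<open>N *v v\<close> lies in \<open>S\<close> and is orthogonal to all of
    \<open>S\<close>, hence to itself.\<close>
  ultimately have "N *v v = 0"
    using inner_eq_zero_iff by blast
  then show thesis
    using that[of v l] v le by (simp add: N)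
qed

text \<open>Induction on the dimension of \<open>S\<close>: split off a unit eigenvector
  \<open>v\<close>, take a root \<open>C\<close> on the orthogonal complement \<open>T\<close> of
  \<open>v\<close> in \<open>S\<close>, and add \<open>sqrt l\<close> times the projection on
  \<open>v\<close>. The last clause carries the induction, since it makes \<open>C\<close>
  annihilate \<open>v\<close>, so that the two summands do not interfere.\<close>

lemma semidefinite_sqrt_on_subspace:
  fixes A :: "real^'n^'n"
  assumes "transpose A = A" "\<And>x. 0 \<le> x \<bullet> (A *v x)" "subspace S"
    and "\<And>x. x \<in> S \<Longrightarrow> A *v x \<in> S"
  shows "\<exists>C :: real^'n^'n. transpose C = C \<and> (\<forall>x. 0 \<le> x \<bullet> (C *v x)) \<and>
    (\<forall>x\<in>S. C *v x \<in> S \<and> C *v (C *v x) = A *v x) \<and> (\<forall>x. (\<forall>y\<in>S. y \<bullet> x = 0) \<longrightarrow> C *v x = 0)"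
  using assms(3,4)
proof (induction "dim S" arbitrary: S rule: less_induct)
  case less
  show ?case
  proof (cases "S = {0}")
    case True
    then show ?thesis
      by (intro exI[of _ 0]) (simp add: transpose_def vec_eq_iff)
  next
    case False
    obtain v l where v: "v \<in> S" "norm v = 1" "A *v v = l *\<^sub>R v"
      by (rule rayleigh_maximum[OF assms(1) less.prems(1) False less.prems(2)]) auto
    have vv: "v \<bullet> v = 1"
      using v by (simp add: norm_eq_1)
    have l: "0 \<le> l"
      using assms(2)[of v] v vv by simp
    define T where "T = S \<inter> {x. v \<bullet> x = 0}"
    have T: "subspace T"
      unfolding T_def by (intro subspace_inter subspace_hyperplane less.prems(1))
    have "T \<subset> S"
      using v(1) vv unfolding T_def by (metis (mono_tags, lifting) IntD2 inf.cobounded1 mem_Collect_eq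
          psubsetI zero_neq_one)
    then have "dim T < dim S"
      using T less.prems(1) by (intro dim_psubset) (simp add: span_eq_iff[THEN iffD2])
    moreover have "A *v x \<in> T" if "x \<in> T" for x
      using that less.prems(2) v inner_symmetric_matrix[OF assms(1), of v x]
      by (simp add: T_def inner_commute)
    ultimately obtain C :: "real^'n^'n" where C: "transpose C = C" "\<And>x. 0 \<le> x \<bullet> (C *v x)"
      "\<And>x. x \<in> T \<Longrightarrow> C *v x \<in> T" "\<And>x. x \<in> T \<Longrightarrow> C *v (C *v x) = A *v x"
      "\<And>x. (\<forall>y\<in>T. y \<bullet> x = 0) \<Longrightarrow> C *v x = 0"
      using less.hyps[of T] T by blast
    define B where "B = C + (\<chi> i j. sqrt l * v $ i * v $ j)"
    have B: "B *v x = C *v x + (sqrt l * (v \<bullet> x)) *\<^sub>R v" for x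
      by (simp add: B_def matrix_vector_mult_add_rdistrib)
        (simp add: matrix_vector_mult_def vec_eq_iff inner_vec_def sum_distrib_left sum_distrib_right
          mult_ac)
    have Bv: "B *v v = sqrt l *\<^sub>R v"
      using C(5)[of v] vv by (simp add: B T_def inner_commute)
    have BT: "B *v x = C *v x" if "x \<in> T" for x
      using that by (simp add: B T_def)
    have decomp: "x - (v \<bullet> x) *\<^sub>R v \<in> T" if "x \<in> S" for x
      using that v vv less.prems(1)
      by (simp add: T_def subspace_diff subspace_scale inner_diff_right)
    have B_split: "B *v x = (sqrt l * (v \<bullet> x)) *\<^sub>R v + C *v (x - (v \<bullet> x) *\<^sub>R v)" if "x \<in> S" for x
    proof -
      have "B *v x = B *v ((v \<bullet> x) *\<^sub>R v + (x - (v \<bullet> x) *\<^sub>R v))"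
        by simp
      also have "\<dots> = (v \<bullet> x) *\<^sub>R (B *v v) + B *v (x - (v \<bullet> x) *\<^sub>R v)"
        by (simp only: matrix_vector_right_distrib matrix_vector_mult_scaleR)
      finally show ?thesis
        using BT[OF decomp[OF that]] by (simp add: Bv mult.commute)
    qed
    have "transpose B = B"
      using C(1) by (simp add: B_def transpose_def vec_eq_iff mult_ac)
    moreover have "0 \<le> x \<bullet> (B *v x)" for x
      using C(2)[of x] l by (simp add: B inner_add_right inner_commute mult.assoc)
    moreover have "B *v x \<in> S" if "x \<in> S" for x
      using B_split[OF that] C(3)[OF decomp[OF that]] v less.prems(1)
      by (simp add: T_def subspace_add subspace_scale)
    moreover have "B *v (B *v x) = A *v x" if "x \<in> S" for x
    proof -
      let ?y = "x - (v \<bullet> x) *\<^sub>R v"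
      have "B *v (B *v x) = (sqrt l * (v \<bullet> x)) *\<^sub>R (B *v v) + B *v (C *v ?y)"
        by (simp only: B_split[OF that] matrix_vector_right_distrib matrix_vector_mult_scaleR)
      also have "\<dots> = (v \<bullet> x) *\<^sub>R (A *v v) + A *v ?y"
        using BT[OF C(3)[OF decomp[OF that]]] C(4)[OF decomp[OF that]] l v by (simp add: Bv mult_ac)
      also have "\<dots> = A *v x"
        by (simp add: matrix_vector_mult_diff_distrib matrix_vector_mult_scaleR)
      finally show ?thesis .
    qed
    moreover have "B *v x = 0" if "\<forall>y\<in>S. y \<bullet> x = 0" for x
      using that v C(5)[of x] by (simp add: B T_def)
    ultimately show ?thesis
      by blast
  qed
qed

lemma pos_semidef_sqrt_exists:
  assumes "pos_semidef A"
  shows "\<exists>B. pos_semidef B \<and> B ** B = A"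
proof -
  obtain B where "transpose B = B" "\<forall>x. 0 \<le> x \<bullet> (B *v x)" "\<forall>x. B *v (B *v x) = A *v x"
    using semidefinite_sqrt_on_subspace[of A UNIV] assms by (auto simp: pos_semidef_def)
  then show ?thesis
    unfolding pos_semidef_def matrix_eq by (metis matrix_vector_mul_assoc)
qed

text \<open>The constant is the smallest eigenvalue of \<open>A\<close>, obtained as minus the
  Rayleigh maximum of \<open>- A\<close>.\<close>

lemma pos_def_coercive:
  assumes "pos_def A"
  obtains c where "c > 0" "\<And>x. c * (x \<bullet> x) \<le> x \<bullet> (A *v x)"
proof -
  have "transpose (- A) = - A"
    using assms by (simp add: pos_def_def transpose_def vec_eq_iff)
  moreover have "(- A) *v x = - (A *v x)" for x
    using matrix_vector_mult_diff_rdistrib[of 0 A x] by simp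
  moreover have "(axis undefined 1 :: real^'a) \<noteq> 0"
    by (simp add: axis_eq_0_iff)
  then have "(UNIV :: (real^'a) set) \<noteq> {0}"
    by blast
  ultimately obtain v l where v: "norm v = 1" "- (A *v v) = l *\<^sub>R v"
    "\<And>x. - (x \<bullet> (A *v x)) \<le> l * (x \<bullet> x)"
    using rayleigh_maximum[of "- A" UNIV] by auto
  have "v \<noteq> 0" "v \<bullet> v = 1"
    using v(1) by (auto simp: norm_eq_1)
  then have "0 < v \<bullet> (A *v v)"
    using assms by (simp add: pos_def_def)
  moreover have "v \<bullet> (A *v v) = - (v \<bullet> (l *\<^sub>R v))"
    by (simp flip: v(2))
  ultimately have "- l > 0"
    using \<open>v \<bullet> v = 1\<close> by simp
  then show thesis
    using that[of "- l"] v(3) by (simp add: minus_le_iff)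
qed

text \<open>From \<open>B ** B - C ** C = B ** (B - C) + (B - C) ** C\<close>, the form of the left
  side at an eigenvector \<open>v\<close> of \<open>B - C\<close> is \<open>l\<close> times the sum
  of the forms of \<open>B\<close> and \<open>C\<close> at \<open>v\<close>, and that sum is at
  least \<open>c\<close>.\<close>

lemma square_difference_eigenvalue:
  fixes B C :: "real^'n^'n"
  assumes B: "pos_semidef B" and C: "transpose C = C" "\<And>x. c * (x \<bullet> x) \<le> x \<bullet> (C *v x)" and c: "c > 0"
    and d: "\<And>x. \<bar>x \<bullet> ((B ** B - C ** C) *v x)\<bar> \<le> d * (x \<bullet> x)"
    and v: "norm v = 1" "(B - C) *v v = l *\<^sub>R v"
  shows "\<bar>l\<bar> \<le> d / c"
proof -
  have vv: "v \<bullet> v = 1"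
    using v by (simp add: norm_eq_1)
  have "v \<bullet> ((B ** B - C ** C) *v v) = v \<bullet> (B *v ((B - C) *v v)) + v \<bullet> ((B - C) *v (C *v v))"
    by (simp add: matrix_vector_mult_diff_rdistrib matrix_vector_mult_diff_distrib inner_diff_right
        flip: matrix_vector_mul_assoc)
  also have "v \<bullet> ((B - C) *v (C *v v)) = ((B - C) *v v) \<bullet> (C *v v)"
  proof -
    have "transpose (B - C) = B - C"
      using B C(1) by (simp add: pos_semidef_def transpose_def vec_eq_iff)
    then show ?thesis
      using inner_matrix_vector[of v "B - C" "C *v v"] by (simp del: transpose_matrix_vector)
  qed
  also have "v \<bullet> (B *v ((B - C) *v v)) + ((B - C) *v v) \<bullet> (C *v v) =
      l * (v \<bullet> (B *v v) + v \<bullet> (C *v v))"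
    unfolding v matrix_vector_mult_scaleR by (simp add: distrib_left)
  finally have "\<bar>l\<bar> * \<bar>v \<bullet> (B *v v) + v \<bullet> (C *v v)\<bar> \<le> d"
    using d[of v] vv by (simp add: abs_mult)
  moreover have "c \<le> \<bar>v \<bullet> (B *v v) + v \<bullet> (C *v v)\<bar>"
  proof -
    have "0 \<le> v \<bullet> (B *v v)"
      using B by (simp add: pos_semidef_def)
    moreover have "c \<le> v \<bullet> (C *v v)"
      using C(2)[of v] vv by simp
    ultimately show ?thesis
      by linarith
  qed
  ultimately have "\<bar>l\<bar> * c \<le> d"
    by (meson abs_ge_zero dual_order.trans mult_left_mono)
  then show ?thesis
    using c by (simp add: field_simps)
qed

text \<open>The extreme values of the form of \<open>B - C\<close> on the unit sphere are
  eigenvalues, found as Rayleigh maxima of \<open>B - C\<close> and of \<open>C - B\<close>. With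
  \<open>d = 0\<close> this gives uniqueness of the square root, with small \<open>d\<close> its
  continuity.\<close>

lemma square_root_difference_bound:
  fixes B C :: "real^'n^'n"
  assumes B: "pos_semidef B" and C: "transpose C = C" "\<And>x. c * (x \<bullet> x) \<le> x \<bullet> (C *v x)" and c: "c > 0"
    and d: "\<And>x. \<bar>x \<bullet> ((B ** B - C ** C) *v x)\<bar> \<le> d * (x \<bullet> x)"
  shows "\<bar>x \<bullet> ((B - C) *v x)\<bar> \<le> d / c * (x \<bullet> x)"
proof -
  have sym: "transpose (B - C) = B - C" "transpose (C - B) = C - B"
    using B C by (simp_all add: pos_semidef_def transpose_def vec_eq_iff)
  have "(axis undefined 1 :: real^'n) \<noteq> 0"
    by (simp add: axis_eq_0_iff)
  then have nz: "(UNIV :: (real^'n) set) \<noteq> {0}"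
    by blast
  note eig = square_difference_eigenvalue[OF B C c d]
  obtain v l where v: "norm v = 1" "(B - C) *v v = l *\<^sub>R v"
    "\<And>x. x \<bullet> ((B - C) *v x) \<le> l * (x \<bullet> x)"
    by (rule rayleigh_maximum[OF sym(1) subspace_UNIV nz]) auto
  obtain w m where w: "norm w = 1" "(C - B) *v w = m *\<^sub>R w"
    "\<And>x. x \<bullet> ((C - B) *v x) \<le> m * (x \<bullet> x)"
    by (rule rayleigh_maximum[OF sym(2) subspace_UNIV nz]) auto
  have neg: "(B - C) *v y = - ((C - B) *v y)" for y
    by (simp add: matrix_vector_mult_diff_rdistrib)
  have "l \<le> d / c"
    using eig[OF v(1,2)] by simp
  moreover have "m \<le> d / c"
    using eig[OF w(1), of "- m"] w(2) by (simp add: neg[of w])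
  ultimately have "l * (x \<bullet> x) \<le> d / c * (x \<bullet> x)" "m * (x \<bullet> x) \<le> d / c * (x \<bullet> x)"
    by (intro mult_right_mono; simp)+
  with v(3)[of x] w(3)[of x] show ?thesis
    by (simp add: neg[of x] abs_le_iff)
qed

lemma pos_def_imp_pos_semidef: "pos_def A \<Longrightarrow> pos_semidef A"
  unfolding pos_def_def pos_semidef_def
  by (metis inner_zero_left less_eq_real_def)

text \<open>Polarization at two basis vectors. The squared norms of their sum and difference always
  add up to 4, also when \<open>i = j\<close>.\<close>

lemma symmetric_entry_bound:
  fixes E :: "real^'n^'n"
  assumes "transpose E = E" "\<And>x. \<bar>x \<bullet> (E *v x)\<bar> \<le> e * (x \<bullet> x)"
  shows "\<bar>E $ i $ j\<bar> \<le> e"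
proof -
  let ?x = "axis i 1 :: real^'n" and ?y = "axis j 1 :: real^'n"
  have "?x \<bullet> (E *v ?y) = E $ i $ j"
    by (simp add: inner_axis' matrix_vector_mult_basis column_def)
  moreover have "4 * (?x \<bullet> (E *v ?y)) = (?x + ?y) \<bullet> (E *v (?x + ?y)) - (?x - ?y) \<bullet> (E *v (?x - ?y))"
    using inner_symmetric_matrix[OF assms(1), of ?x ?y]
    by (simp add: matrix_vector_right_distrib matrix_vector_mult_diff_distrib inner_add inner_diff)
  moreover have "e * ((?x + ?y) \<bullet> (?x + ?y)) + e * ((?x - ?y) \<bullet> (?x - ?y)) = 4 * e"
    by (simp add: inner_add inner_diff inner_axis_axis algebra_simps)
  ultimately show ?thesis
    using assms(2)[of "?x + ?y"] assms(2)[of "?x - ?y"] by linarith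
qed

text \<open>If the form of \<open>B\<close> vanished at \<open>x\<close>, then \<open>B *v x\<close>
  would be zero by \<open>semidefinite_null_vector\<close>, and hence so would
  \<open>A *v x\<close>.\<close>

lemma pos_semidef_sqrt_pos_def:
  assumes A: "pos_def A" and B: "pos_semidef B" "B ** B = A"
  shows "pos_def B"
  unfolding pos_def_def
proof (intro conjI allI impI)
  show "transpose B = B"
    using B by (simp add: pos_semidef_def)
  show "0 < x \<bullet> (B *v x)" if "x \<noteq> 0" for x
  proof (rule ccontr)
    assume "\<not> 0 < x \<bullet> (B *v x)"
    then have "x \<bullet> (B *v x) = 0"
      using B(1) by (simp add: pos_semidef_def order.antisym)
    then have "(B *v x) \<bullet> (B *v x) = 0"
      using B(1) semidefinite_null_vector[of B UNIV x "B *v x"] by (simp add: pos_semidef_def)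
    then have "A *v x = 0"
      by (simp flip: B(2) matrix_vector_mul_assoc)
    then show False
      using A that by (metis inner_zero_right less_irrefl pos_def_def)
  qed
qed

text \<open>The definite description needs uniqueness, which is the perturbation bound for two roots
  of the same matrix.\<close>

lemma msqrt_eqI:
  assumes A: "pos_def A" and B: "pos_semidef B" "B ** B = A"
  shows "msqrt A = B"
  unfolding msqrt_def
proof (rule the_equality)
  fix C assume C: "pos_semidef C \<and> C ** C = A"
  have sym: "transpose B = B" "transpose (C - B) = C - B"
    using B C by (simp_all add: pos_semidef_def transpose_def vec_eq_iff)
  obtain c where c: "c > 0" "\<And>x. c * (x \<bullet> x) \<le> x \<bullet> (B *v x)"
    using pos_def_coercive[OF pos_semidef_sqrt_pos_def[OF A B]] by blast
  have "\<bar>x \<bullet> ((C - B) *v x)\<bar> \<le> 0 / c * (x \<bullet> x)" for x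
    by (rule square_root_difference_bound[OF _ sym(1) c(2) c(1)]) (use B C in auto)
  then have "\<bar>(C - B) $ i $ j\<bar> \<le> 0" for i j
    by (intro symmetric_entry_bound[OF sym(2)]) simp
  then show "C = B"
    by (simp add: vec_eq_iff)
qed (use B in simp)

lemma msqrt_pos_def: "pos_def A \<Longrightarrow> pos_def (msqrt A)"
  and msqrt_square: "pos_def A \<Longrightarrow> msqrt A ** msqrt A = A"
proof -
  assume A: "pos_def A"
  obtain B where B: "pos_semidef B" "B ** B = A"
    using pos_semidef_sqrt_exists[OF pos_def_imp_pos_semidef[OF A]] by blast
  then show "pos_def (msqrt A)" "msqrt A ** msqrt A = A"
    using msqrt_eqI[OF A B] pos_semidef_sqrt_pos_def[OF A B] by auto
qed

lemma msqrt_scaleR: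
  assumes A: "pos_def A" and c: "c > 0"
  shows "msqrt (c *\<^sub>R A) = sqrt c *\<^sub>R msqrt A"
proof (rule msqrt_eqI)
  show "pos_def (c *\<^sub>R A)"
    using A c by (simp add: pos_def_def transpose_scalar flip: scaleR_matrix_vector_assoc)
  show "pos_semidef (sqrt c *\<^sub>R msqrt A)"
    using pos_def_imp_pos_semidef[OF msqrt_pos_def[OF A]] c
    by (simp add: pos_semidef_def transpose_scalar flip: scaleR_matrix_vector_assoc)
  show "(sqrt c *\<^sub>R msqrt A) ** (sqrt c *\<^sub>R msqrt A) = c *\<^sub>R A"
  proof -
    have "(sqrt c *\<^sub>R msqrt A) ** (sqrt c *\<^sub>R msqrt A) = c *\<^sub>R (msqrt A ** msqrt A)"
      using c by (simp add: scalar_matrix_assoc matrix_scalar_ac)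
    then show ?thesis
      by (simp only: msqrt_square[OF A])
  qed
qed

lemma quadratic_form_bound: "\<bar>x \<bullet> (E *v x)\<bar> \<le> (\<Sum>i\<in>UNIV. \<Sum>j\<in>UNIV. \<bar>E $ i $ j\<bar>) * (x \<bullet> x)"
  for E :: "real^'n^'n"
proof -
  have "x \<bullet> (E *v x) = (\<Sum>i\<in>UNIV. \<Sum>j\<in>UNIV. E $ i $ j * (x $ i * x $ j))"
    by (simp add: inner_vec_def matrix_vector_mult_def sum_distrib_left mult_ac)
  also have "\<bar>\<dots>\<bar> \<le> (\<Sum>i\<in>UNIV. \<Sum>j\<in>UNIV. \<bar>E $ i $ j * (x $ i * x $ j)\<bar>)"
    by (intro order_trans[OF sum_abs] sum_mono sum_abs)
  also have "\<dots> \<le> (\<Sum>i\<in>UNIV. \<Sum>j\<in>UNIV. \<bar>E $ i $ j\<bar> * (x \<bullet> x))"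
  proof (intro sum_mono)
    fix i j
    have "\<bar>x $ i\<bar> * \<bar>x $ j\<bar> \<le> norm x * norm x"
      by (intro mult_mono component_le_norm_cart) auto
    then show "\<bar>E $ i $ j * (x $ i * x $ j)\<bar> \<le> \<bar>E $ i $ j\<bar> * (x \<bullet> x)"
      by (simp add: abs_mult mult_left_mono dot_square_norm power2_eq_square)
  qed
  finally show ?thesis
    by (simp add: sum_distrib_right)
qed

text \<open>The coercivity constant \<open>c\<close> belongs to the root of the limit alone, so it
  is the same for every \<open>n\<close>, and the entries of the roots differ by at most
  \<open>1 / c\<close> times the entrywise distance of \<open>A n\<close> from
  \<open>D\<close>.\<close>

lemma tendsto_msqrt:
  fixes A :: "'a \<Rightarrow> real^'n^'n"
  assumes D: "pos_def D" and lim: "(A \<longlongrightarrow> D) F" and pd: "\<forall>\<^sub>F n in F. pos_def (A n)"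
  shows "((\<lambda>n. msqrt (A n)) \<longlongrightarrow> msqrt D) F"
proof (intro vec_tendstoI)
  fix i j
  have sym: "transpose (msqrt D) = msqrt D"
    using msqrt_pos_def[OF D] by (simp add: pos_def_def)
  obtain c where c: "c > 0" "\<And>x. c * (x \<bullet> x) \<le> x \<bullet> (msqrt D *v x)"
    using pos_def_coercive[OF msqrt_pos_def[OF D]] by blast
  define d where "d n = (\<Sum>i\<in>UNIV. \<Sum>j\<in>UNIV. \<bar>(A n - D) $ i $ j\<bar>)" for n
  have "(d \<longlongrightarrow> (\<Sum>i\<in>UNIV. \<Sum>j\<in>UNIV. \<bar>(D - D) $ i $ j\<bar>)) F"
    unfolding d_def by (intro tendsto_intros lim)
  then have lim_d: "((\<lambda>n. d n / c) \<longlongrightarrow> 0) F"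
    using tendsto_divide_zero by force
  have ev: "\<forall>\<^sub>F n in F. norm (msqrt (A n) $ i $ j - msqrt D $ i $ j) \<le> d n / c"
    using pd
  proof eventually_elim
    case (elim n)
    let ?B = "msqrt (A n)"
    have B: "pos_semidef ?B"
      using elim by (intro pos_def_imp_pos_semidef msqrt_pos_def)
    have "\<bar>x \<bullet> ((?B - msqrt D) *v x)\<bar> \<le> d n / c * (x \<bullet> x)" for x
      by (rule square_root_difference_bound[OF B sym c(2) c(1)])
        (simp add: msqrt_square[OF D] msqrt_square[OF elim] d_def quadratic_form_bound
          del: vector_minus_component)
    moreover have "transpose (?B - msqrt D) = ?B - msqrt D"
      using B sym by (simp add: pos_semidef_def transpose_def vec_eq_iff)
    ultimately show ?case
      using symmetric_entry_bound[of "?B - msqrt D"] by simp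
  qed
  show "((\<lambda>n. msqrt (A n) $ i $ j) \<longlongrightarrow> msqrt D $ i $ j) F"
    by (rule LIM_zero_cancel[OF Lim_null_comparison[OF ev lim_d]])
qed

section \<open>Inverses and inverse square roots of positive definite matrices\<close>

lemma pos_def_invertible: "pos_def A \<Longrightarrow> invertible A"
  unfolding invertible_left_inverse matrix_left_invertible_ker pos_def_def by fastforce

lemma matrix_inv_left: "invertible A \<Longrightarrow> matrix_inv A ** A = mat 1"
  and matrix_inv_right: "invertible A \<Longrightarrow> A ** matrix_inv A = mat 1"
  for A :: "real^'n^'n"
proof -
  assume "invertible A"
  then have "A ** matrix_inv A = mat 1 \<and> matrix_inv A ** A = mat 1"
    unfolding matrix_inv_def invertible_def by (rule someI_ex)
  then show "matrix_inv A ** A = mat 1" "A ** matrix_inv A = mat 1"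
    by auto
qed

lemma matrix_inv_eqI:
  fixes A B :: "real^'n^'n"
  assumes "A ** B = mat 1"
  shows "matrix_inv A = B"
proof -
  have "invertible A"
    using assms invertible_right_inverse by blast
  then show ?thesis
    by (metis assms matrix_inv_left matrix_mul_assoc matrix_mul_lid matrix_mul_rid)
qed

lemma matrix_inv_pos_def:
  assumes A: "pos_def A"
  shows "pos_def (matrix_inv A)"
proof -
  note inv = matrix_inv_left[OF pos_def_invertible[OF A]] matrix_inv_right[OF pos_def_invertible[OF A]]
  have "A ** transpose (matrix_inv A) = mat 1"
    using inv(1) A by (metis matrix_transpose_mul pos_def_def transpose_mat)
  then have sym: "transpose (matrix_inv A) = matrix_inv A"
    using matrix_inv_eqI by metis
  moreover have "0 < x \<bullet> (matrix_inv A *v x)" if "x \<noteq> 0" for x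
  proof -
    let ?y = "matrix_inv A *v x"
    have x: "x = A *v ?y"
      by (simp add: matrix_vector_mul_assoc inv)
    with that have "?y \<noteq> 0"
      by auto
    then have "0 < ?y \<bullet> (A *v ?y)"
      using A by (simp add: pos_def_def)
    then show ?thesis
      by (simp flip: x add: inner_commute)
  qed
  ultimately show ?thesis
    by (simp add: pos_def_def)
qed

lemma inv_msqrt_pos_def: "pos_def A \<Longrightarrow> pos_def (inv_msqrt A)"
  unfolding inv_msqrt_def by (intro matrix_inv_pos_def msqrt_pos_def)

lemma inv_msqrt_mult:
  assumes "pos_def A"
  shows "inv_msqrt A ** A = msqrt A" "inv_msqrt A ** inv_msqrt A ** A = mat 1"
proof -
  have *: "inv_msqrt A ** msqrt A = mat 1"
    unfolding inv_msqrt_def using assms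
    by (intro matrix_inv_left pos_def_invertible msqrt_pos_def)
  then show "inv_msqrt A ** A = msqrt A"
    by (metis assms matrix_mul_assoc matrix_mul_lid msqrt_square)
  then show "inv_msqrt A ** inv_msqrt A ** A = mat 1"
    using * by (simp flip: matrix_mul_assoc)
qed

lemma inv_msqrt_square:
  assumes "pos_def A"
  shows "inv_msqrt A ** inv_msqrt A = matrix_inv A"
  by (metis assms inv_msqrt_mult(2) matrix_inv_right matrix_mul_assoc matrix_mul_lid matrix_mul_rid
      pos_def_invertible)

section \<open>Linear functionals of Gaussian vectors\<close>

text \<open>Completing the square in \<open>s\<close> leaves a multiple of the normal density with
  mean \<open>y / v\<close> and variance \<open>1 / v\<close>.\<close>

lemma nn_integral_gaussian_tilt:
  fixes v y :: real
  assumes v: "v > 0"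
  shows "(\<integral>\<^sup>+s. ennreal (exp (s * y - s\<^sup>2 * v / 2)) \<partial>lborel) = ennreal (sqrt (2 * pi / v) * exp (y\<^sup>2 / (2 * v)))"
proof -
  have "exp (s * y - s\<^sup>2 * v / 2) =
      sqrt (2 * pi / v) * exp (y\<^sup>2 / (2 * v)) * normal_density (y / v) (1 / sqrt v) s" for s
  proof -
    have "s * y - s\<^sup>2 * v / 2 = y\<^sup>2 / (2 * v) + - (s - y / v)\<^sup>2 / (2 * (1 / sqrt v)\<^sup>2)"
      using v by (simp add: field_simps power2_eq_square)
    then show ?thesis
      using v by (simp add: normal_density_def mult_exp_exp power_divide)
  qed
  then have "(\<integral>\<^sup>+s. ennreal (exp (s * y - s\<^sup>2 * v / 2)) \<partial>lborel) =
      (\<integral>\<^sup>+s. ennreal (sqrt (2 * pi / v) * exp (y\<^sup>2 / (2 * v))) * ennreal (normal_density (y / v) (1 / sqrt v) s) \<partial>lborel)"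
    by (intro nn_integral_cong) (simp add: ennreal_mult' v less_imp_le)
  also have "\<dots> = ennreal (sqrt (2 * pi / v) * exp (y\<^sup>2 / (2 * v))) *
      (\<integral>\<^sup>+s. ennreal (normal_density (y / v) (1 / sqrt v) s) \<partial>lborel)"
    by (intro nn_integral_cmult) simp
  also have "(\<integral>\<^sup>+s. ennreal (normal_density (y / v) (1 / sqrt v) s) \<partial>lborel) = 1"
    using prob_space.emeasure_space_1[OF prob_space_normal_density[of "1 / sqrt v" "y / v"]] v
    by (simp add: emeasure_density)
  finally show ?thesis
    by simp
qed

text \<open>Translating by \<open>s *\<^sub>R h\<close> and integrating over \<open>s\<close> against Lebesgue measure determines the
  law of \<open>l \<bullet> x\<close> from the way the density changes under the translation; neither the
  normalizing constant nor a linear change of variables is needed.\<close>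

lemma gaussian_projection:
  fixes p :: "'a::euclidean_space \<Rightarrow> ennreal"
  assumes [measurable]: "p \<in> borel_measurable borel"
    and mass: "(\<integral>\<^sup>+x. p x \<partial>lborel) = 1"
    and shift: "\<And>s x. p (x - s *\<^sub>R h) = p x * ennreal (exp (s * (l \<bullet> x) - s\<^sup>2 * v / 2))"
    and lh: "l \<bullet> h = v" and v: "v > 0"
  shows "distr (density lborel p) borel (\<lambda>x. l \<bullet> x) = normal_law 0 v"
proof (rule measure_eqI)
  fix A assume "A \<in> sets (distr (density lborel p) borel (\<lambda>x. l \<bullet> x))"
  then have [measurable]: "A \<in> sets borel"
    by simp
  \<comment> \<open>The unnormalized density of the target law, cut to \<open>A\<close>. Its
    exponential is the reciprocal of the one produced by \<open>nn_integral_gaussian_tilt\<close>,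
    so that only the indicator survives in \<open>gauss\<close>.\<close>
  define f where "f y = ennreal (exp (- y\<^sup>2 / (2 * v))) * indicator A y" for y
  have [measurable]: "f \<in> borel_measurable borel"
    unfolding f_def by measurable
  have translate: "(\<integral>\<^sup>+x. p x * f (l \<bullet> x + s * v) \<partial>lborel) =
      (\<integral>\<^sup>+x. p x * ennreal (exp (s * (l \<bullet> x) - s\<^sup>2 * v / 2)) * f (l \<bullet> x) \<partial>lborel)" for s
  proof -
    have "(\<integral>\<^sup>+x. p x * f (l \<bullet> x + s * v) \<partial>lborel) =
        (\<integral>\<^sup>+x. p x * f (l \<bullet> x + s * v) \<partial>distr lborel borel ((+) (- (s *\<^sub>R h))))"
      by (simp only: lborel_distr_plus)
    also have "\<dots> = (\<integral>\<^sup>+x. p (x - s *\<^sub>R h) * f (l \<bullet> x) \<partial>lborel)"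
      by (subst nn_integral_distr) (auto simp: inner_diff_right lh intro!: nn_integral_cong)
    finally show ?thesis
      by (simp add: shift)
  qed
  have scale: "(\<integral>\<^sup>+s. f (y + s * v) \<partial>lborel) = ennreal (1 / v) * (\<integral>\<^sup>+y. f y \<partial>lborel)" for y
  proof -
    have "ennreal (1 / v) * (\<integral>\<^sup>+y. f y \<partial>lborel) = ennreal (1 / v) * (ennreal v * (\<integral>\<^sup>+s. f (y + v * s) \<partial>lborel))"
      using v by (subst nn_integral_real_affine[of f v y]) auto
    also have "\<dots> = (\<integral>\<^sup>+s. f (y + s * v) \<partial>lborel)"
      using v by (simp add: mult.assoc[symmetric] ennreal_mult[symmetric] mult.commute)
    finally show ?thesis ..
  qed
  have gauss: "(\<integral>\<^sup>+s. ennreal (exp (s * y - s\<^sup>2 * v / 2)) \<partial>lborel) * f y =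
      ennreal (sqrt (2 * pi / v)) * indicator A y" for y
    using v unfolding nn_integral_gaussian_tilt[OF v] f_def mult.assoc[symmetric]
    by (simp add: ennreal_mult[symmetric] mult.assoc exp_add[symmetric])
  \<comment> \<open>One double integral is evaluated in two orders. Integrating over
    \<open>s\<close> first gives the target mass of \<open>A\<close>. Translating in
    \<open>x\<close> for fixed \<open>s\<close> and then integrating over \<open>s\<close> gives the
    probability that \<open>l \<bullet> x\<close> lies in \<open>A\<close>.\<close>
  have "ennreal (1 / v) * (\<integral>\<^sup>+y. f y \<partial>lborel) =
      (\<integral>\<^sup>+x. p x * (ennreal (1 / v) * (\<integral>\<^sup>+y. f y \<partial>lborel)) \<partial>lborel)"
    by (subst nn_integral_multc) (auto simp: mass)
  also have "\<dots> = (\<integral>\<^sup>+x. p x * (\<integral>\<^sup>+s. f (l \<bullet> x + s * v) \<partial>lborel) \<partial>lborel)"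
    by (simp only: scale)
  also have "\<dots> = (\<integral>\<^sup>+x. (\<integral>\<^sup>+s. p x * f (l \<bullet> x + s * v) \<partial>lborel) \<partial>lborel)"
    by (intro nn_integral_cong nn_integral_cmult[symmetric]) measurable
  also have "\<dots> = (\<integral>\<^sup>+s. (\<integral>\<^sup>+x. p x * f (l \<bullet> x + s * v) \<partial>lborel) \<partial>lborel)"
    by (rule lborel_pair.Fubini') measurable
  also have "\<dots> = (\<integral>\<^sup>+s. (\<integral>\<^sup>+x. p x * ennreal (exp (s * (l \<bullet> x) - s\<^sup>2 * v / 2)) * f (l \<bullet> x) \<partial>lborel) \<partial>lborel)"
    by (simp only: translate)
  also have "\<dots> = (\<integral>\<^sup>+x. (\<integral>\<^sup>+s. p x * ennreal (exp (s * (l \<bullet> x) - s\<^sup>2 * v / 2)) * f (l \<bullet> x) \<partial>lborel) \<partial>lborel)"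
    by (rule lborel_pair.Fubini') measurable
  also have "\<dots> = (\<integral>\<^sup>+x. p x * ((\<integral>\<^sup>+s. ennreal (exp (s * (l \<bullet> x) - s\<^sup>2 * v / 2)) \<partial>lborel) * f (l \<bullet> x)) \<partial>lborel)"
    by (intro nn_integral_cong) (simp add: nn_integral_cmult nn_integral_multc mult.assoc)
  also have "\<dots> = ennreal (sqrt (2 * pi / v)) * (\<integral>\<^sup>+x. p x * indicator A (l \<bullet> x) \<partial>lborel)"
    unfolding gauss by (subst nn_integral_cmult[symmetric]) (auto simp: mult_ac)
  finally have eq: "ennreal (1 / v) * (\<integral>\<^sup>+y. f y \<partial>lborel) =
      ennreal (sqrt (2 * pi / v)) * (\<integral>\<^sup>+x. p x * indicator A (l \<bullet> x) \<partial>lborel)" .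
  have "sqrt (v / (2 * pi)) * sqrt (2 * pi / v) = 1"
    using v by (simp flip: real_sqrt_mult)
  then have unit: "ennreal (sqrt (v / (2 * pi))) * ennreal (sqrt (2 * pi / v)) = 1"
    using v by (simp add: ennreal_mult[symmetric])
  have const: "sqrt (v / (2 * pi)) * (1 / v) = 1 / sqrt (2 * pi * v)"
    using v by (simp add: real_sqrt_mult real_sqrt_divide field_simps)
  have "(\<lambda>x. l \<bullet> x) -` A \<in> sets borel"
    by (rule measurable_sets_borel[of _ borel]) auto
  then have "emeasure (distr (density lborel p) borel (\<lambda>x. l \<bullet> x)) A =
      (\<integral>\<^sup>+x. p x * indicator A (l \<bullet> x) \<partial>lborel)"
    by (subst emeasure_distr) (auto simp: emeasure_density indicator_def intro!: nn_integral_cong)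
  also have "\<dots> = ennreal (sqrt (v / (2 * pi))) *
      (ennreal (sqrt (2 * pi / v)) * (\<integral>\<^sup>+x. p x * indicator A (l \<bullet> x) \<partial>lborel))"
    by (simp add: mult.assoc[symmetric] unit)
  also have "\<dots> = ennreal (sqrt (v / (2 * pi)) * (1 / v)) * (\<integral>\<^sup>+y. f y \<partial>lborel)"
    using v by (simp add: eq[symmetric] mult.assoc[symmetric] ennreal_mult[symmetric])
  also have "\<dots> = ennreal (1 / sqrt (2 * pi * v)) * (\<integral>\<^sup>+y. f y \<partial>lborel)"
    by (simp only: const)
  also have "\<dots> = (\<integral>\<^sup>+y. ennreal (normal_density 0 (sqrt v) y) * indicator A y \<partial>lborel)"
    using v by (subst nn_integral_cmult[symmetric])
      (auto simp: f_def normal_density_def mult.assoc[symmetric] ennreal_mult[symmetric] intro!: nn_integral_cong)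
  also have "\<dots> = emeasure (normal_law 0 v) A"
    unfolding normal_law_def by (subst emeasure_density) auto
  finally show "emeasure (distr (density lborel p) borel (\<lambda>x. l \<bullet> x)) A = emeasure (normal_law 0 v) A" .
qed (simp add: normal_law_def)

section \<open>Continuous mapping under continuous convergence\<close>

text \<open>Near each point both \<open>F m\<close> and \<open>f\<close> are close to the value of
  \<open>f\<close> there, once \<open>m\<close> is large. Finitely many such neighbourhoods cover
  \<open>K\<close>, and the largest of their thresholds serves all of \<open>K\<close>.\<close>

lemma uniform_on_compact_of_continuous_convergence:
  fixes F :: "nat \<Rightarrow> 'b::t2_space \<Rightarrow> 'c::metric_space"
  assumes K: "compact K" and f: "continuous_on UNIV f"
    and F: "\<And>x. ((\<lambda>p. F (fst p) (snd p)) \<longlongrightarrow> f x) (sequentially \<times>\<^sub>F nhds x)"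
  shows "uniform_limit K F f sequentially"
proof (rule uniform_limitI)
  fix e :: real assume e: "e > 0"
  have "\<exists>U n. open U \<and> x \<in> U \<and> (\<forall>m\<ge>n. \<forall>y\<in>U. dist (F m y) (f y) < e)" for x
  proof -
    have "eventually (\<lambda>p. dist (F (fst p) (snd p)) (f x) < e / 2) (sequentially \<times>\<^sub>F nhds x)"
      using F[of x] e by (intro tendstoD) auto
    then obtain P Q where P: "eventually P sequentially" and Q: "eventually Q (nhds x)"
      and PQ: "\<And>m y. P m \<Longrightarrow> Q y \<Longrightarrow> dist (F m y) (f x) < e / 2"
      by (auto simp: eventually_prod_filter)
    have "isCont f x"
      using f by (simp add: continuous_on_eq_continuous_at)
    then have "(f \<longlongrightarrow> f x) (nhds x)"
      by (simp only: isCont_def tendsto_at_iff_tendsto_nhds)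
    then have "eventually (\<lambda>y. dist (f y) (f x) < e / 2) (nhds x)"
      using e by (intro tendstoD) auto
    with Q have "eventually (\<lambda>y. Q y \<and> dist (f y) (f x) < e / 2) (nhds x)"
      by (rule eventually_conj)
    then obtain U where U: "open U" "x \<in> U" "\<And>y. y \<in> U \<Longrightarrow> Q y \<and> dist (f y) (f x) < e / 2"
      by (auto simp: eventually_nhds)
    obtain n where "\<And>m. m \<ge> n \<Longrightarrow> P m"
      using P by (auto simp: eventually_sequentially)
    then have "dist (F m y) (f y) < e" if "m \<ge> n" "y \<in> U" for m y
      using PQ[of m y] U(3)[OF that(2)] that(1) dist_triangle_half_l[of "F m y" "f x" e "f y"]
      by (auto simp: dist_commute)
    with U show ?thesis
      by blast
  qed
  then obtain U n where U: "\<And>x. open (U x)" "\<And>x. x \<in> U x"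
    "\<And>x m y. m \<ge> n x \<Longrightarrow> y \<in> U x \<Longrightarrow> dist (F m y) (f y) < e"
    by metis
  obtain C where C: "C \<subseteq> K" "finite C" "K \<subseteq> (\<Union>x\<in>C. U x)"
    using compactE_image[OF K, of K U] U(1,2) by blast
  \<comment> \<open>The inserted 0 keeps the maximum meaningful when \<open>C\<close> is
    empty.\<close>
  have "\<forall>x\<in>K. dist (F m x) (f x) < e" if "m \<ge> Max (insert 0 (n ` C))" for m
    using C U(3) that by fastforce
  then show "\<forall>\<^sub>F m in sequentially. \<forall>x\<in>K. dist (F m x) (f x) < e"
    by (auto simp: eventually_sequentially)
qed

text \<open>The extended continuous mapping theorem, in which the map varies with \<open>n\<close>.
  On a large ball \<open>F n\<close> is uniformly close to \<open>f\<close> after composition with a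
  test function. The mass outside the ball is small for the limit law, and weak convergence carries
  this over to \<open>N n\<close>.\<close>

lemma weak_conv_continuous_convergence_mapping:
  fixes N :: "nat \<Rightarrow> 'b::euclidean_space measure" and F :: "nat \<Rightarrow> 'b \<Rightarrow> real"
  assumes N: "\<And>n. prob_space (N n)" "\<And>n. sets (N n) = sets borel"
    and L: "prob_space L" "sets L = sets borel"
    and wc: "weakly_converges N L"
    and F_meas: "\<And>n. F n \<in> borel_measurable borel"
    and f: "continuous_on UNIV f"
    and F: "\<And>x. ((\<lambda>p. F (fst p) (snd p)) \<longlongrightarrow> f x) (sequentially \<times>\<^sub>F nhds x)"
  shows "weak_conv_m (\<lambda>n. distr (N n) borel (F n)) (distr L borel f)"
proof (rule integral_bdd_continuous_conv_imp_weak_conv)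
  note [measurable_cong] = N(2) L(2)
  note [measurable] = F_meas
  have [measurable]: "f \<in> borel_measurable borel"
    using f by (rule borel_measurable_continuous_onI)
  interpret N: prob_space "N n" for n by (rule N)
  interpret L: prob_space L by (rule L)
  show "real_distribution (distr (N n) borel (F n))" for n
    by (intro N.real_distribution_distr) measurable
  show "real_distribution (distr L borel f)"
    by (intro L.real_distribution_distr) measurable
  fix h :: "real \<Rightarrow> real"
  assume h: "\<And>x. isCont h x" "\<And>x. \<bar>h x\<bar> \<le> 1"
  have hc: "continuous_on UNIV h"
    using h(1) by (simp add: continuous_on_eq_continuous_at)
  have [measurable]: "h \<in> borel_measurable borel"
    using hc by (rule borel_measurable_continuous_onI)
  have hf: "continuous_on UNIV (\<lambda>x. h (f x))"
    using continuous_on_compose2[OF hc f] by simp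
  \<comment> \<open>A continuous substitute for the indicator of the complement of a ball: 0 up to
    radius \<open>k\<close>, 1 from radius \<open>k + 1\<close> on. Being continuous and bounded, it
    may be used as a test function.\<close>
  define \<phi> where "\<phi> k x = min 1 (max 0 (norm x - real k))" for k and x :: 'b
  have \<phi>c: "continuous_on UNIV (\<phi> k)" for k
    unfolding \<phi>_def by (intro continuous_intros)
  have [measurable]: "\<phi> k \<in> borel_measurable borel" for k
    using \<phi>c by (rule borel_measurable_continuous_onI)
  have \<phi>01: "0 \<le> \<phi> k x" "\<phi> k x \<le> 1" for k x
    by (auto simp: \<phi>_def)
  have lim_bounded: "(\<lambda>n. \<integral>x. g x \<partial>N n) \<longlonglongrightarrow> (\<integral>x. g x \<partial>L)"
    if "continuous_on UNIV g" "\<And>x. \<bar>g x\<bar> \<le> 1" for g :: "'b \<Rightarrow> real"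
    using wc that by (auto simp: weakly_converges_def bounded_iff)
  have tight: "(\<lambda>k. \<integral>x. \<phi> k x \<partial>L) \<longlonglongrightarrow> (\<integral>x. 0 \<partial>L)"
  proof (rule integral_dominated_convergence[where w = "\<lambda>_. 1"])
    have "(\<lambda>k. \<phi> k x) \<longlonglongrightarrow> 0" for x
    proof (rule tendsto_eventually)
      obtain k0 where "norm x \<le> real k0"
        using real_arch_simple by blast
      then show "\<forall>\<^sub>F k in sequentially. \<phi> k x = 0"
        by (intro eventually_sequentiallyI[of k0]) (auto simp: \<phi>_def max_def)
    qed
    then show "AE x in L. (\<lambda>k. \<phi> k x) \<longlonglongrightarrow> 0"
      by simp
  qed (use \<phi>01 in auto)
  have diff: "(\<lambda>n. (\<integral>x. h (F n x) \<partial>N n) - (\<integral>x. h (f x) \<partial>N n)) \<longlonglongrightarrow> 0"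
  proof (rule LIMSEQ_I)
    fix r :: real assume "r > 0"
    \<comment> \<open>The error is at most \<open>e\<close> from the ball plus twice a tail mass
      below \<open>e\<close>.\<close>
    define e where "e = r / 4"
    have e: "e > 0"
      using \<open>r > 0\<close> by (simp add: e_def)
    obtain k where k: "(\<integral>x. \<phi> k x \<partial>L) < e"
      using order_tendstoD(2)[OF tight, of e] e by (auto simp: eventually_sequentially)
    have "\<forall>\<^sub>F n in sequentially. (\<integral>x. \<phi> k x \<partial>N n) < e"
      using lim_bounded[OF \<phi>c, of k] \<phi>01 k by (intro order_tendstoD) auto
    moreover have "uniform_limit (cball 0 (real k + 1)) (\<lambda>n x. h (F n x)) (\<lambda>x. h (f x)) sequentially"
      by (intro uniform_on_compact_of_continuous_convergence hf isCont_tendsto_compose[OF h(1)] F) auto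
    then have "\<forall>\<^sub>F n in sequentially. \<forall>x\<in>cball 0 (real k + 1). dist (h (F n x)) (h (f x)) < e"
      using e by (rule uniform_limitD)
    ultimately have "\<forall>\<^sub>F n in sequentially. norm ((\<integral>x. h (F n x) \<partial>N n) - (\<integral>x. h (f x) \<partial>N n) - 0) < r"
    proof eventually_elim
      case (elim n)
      have int: "integrable (N n) (\<lambda>x. h (F n x))" "integrable (N n) (\<lambda>x. h (f x))"
        "integrable (N n) (\<phi> k)"
        using h(2) \<phi>01 by (auto intro!: N.integrable_const_bound[where B = 1])
      have bound: "\<bar>h (F n x) - h (f x)\<bar> \<le> e + 2 * \<phi> k x" for x
      proof (cases "norm x \<le> real k + 1")
        case True
        then show ?thesis
          using bspec[OF elim(2), of x] \<phi>01(1)[of k x] by (simp add: dist_real_def)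
      next
        case False
        then have "\<phi> k x = 1"
          by (simp add: \<phi>_def)
        then show ?thesis
          using h(2)[of "F n x"] h(2)[of "f x"] e by linarith
      qed
      have "\<bar>(\<integral>x. h (F n x) \<partial>N n) - (\<integral>x. h (f x) \<partial>N n)\<bar> = \<bar>\<integral>x. h (F n x) - h (f x) \<partial>N n\<bar>"
        using int by simp
      also have "\<dots> \<le> (\<integral>x. \<bar>h (F n x) - h (f x)\<bar> \<partial>N n)"
        by (rule integral_abs_bound)
      also have "\<dots> \<le> (\<integral>x. e + 2 * \<phi> k x \<partial>N n)"
        using int bound by (intro integral_mono) auto
      also have "\<dots> = e + 2 * (\<integral>x. \<phi> k x \<partial>N n)"
        using int by (simp add: N.prob_space)
      also have "\<dots> < r"
        using elim(1) e by (simp add: e_def)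
      finally show ?case
        by simp
    qed
    then show "\<exists>n0. \<forall>n\<ge>n0. norm ((\<integral>x. h (F n x) \<partial>N n) - (\<integral>x. h (f x) \<partial>N n) - 0) < r"
      by (simp add: eventually_sequentially)
  qed
  have "(\<lambda>n. (\<integral>x. h (F n x) \<partial>N n)) \<longlonglongrightarrow> (\<integral>x. h (f x) \<partial>L)"
    using tendsto_add[OF diff lim_bounded[OF hf]] h(2) by simp
  then show "(\<lambda>n. integral\<^sup>L (distr (N n) borel (F n)) h) \<longlonglongrightarrow> integral\<^sup>L (distr L borel f) h"
    by (simp add: integral_distr)
qed

section \<open>Block algebra of the model\<close>

lemma row_kron_id_mult_vec: "(row_kron_id a *v x) $ i = (\<Sum>r\<in>UNIV. a $ r * x $ (r, i))"
proof -
  have "(row_kron_id a *v x) $ i = (\<Sum>q\<in>UNIV \<times> UNIV. a $ fst q * mat 1 $ i $ snd q * x $ q)"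
    by (simp add: row_kron_id_def matrix_vector_mult_def)
  also have "\<dots> = (\<Sum>r\<in>UNIV. \<Sum>j\<in>UNIV. a $ r * mat 1 $ i $ j * x $ (r, j))"
    by (simp add: sum.cartesian_product split_def del: UNIV_Times_UNIV)
  also have "\<dots> = (\<Sum>r\<in>UNIV. \<Sum>j\<in>UNIV. if i = j then a $ r * x $ (r, j) else 0)"
    by (intro sum.cong refl) (simp add: mat_def)
  finally show ?thesis
    by simp
qed

lemma transpose_row_kron_id_mult_vec: "(transpose (row_kron_id a) *v y) $ q = a $ fst q * y $ snd q"
proof -
  have "(transpose (row_kron_id a) *v y) $ q = (\<Sum>i\<in>UNIV. if i = snd q then a $ fst q * y $ i else 0)"
    unfolding matrix_vector_mult_def transpose_def row_kron_id_def
    by (simp add: mat_def if_distrib[of "(*) _"] if_distrib[of "\<lambda>t. t * _"] cong: if_cong)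
  then show ?thesis
    by simp
qed

lemma row_kron_id_mult_transpose: "row_kron_id a ** transpose (row_kron_id b) = (a \<bullet> b) *\<^sub>R mat 1"
  unfolding matrix_eq
proof
  fix y
  show "row_kron_id a ** transpose (row_kron_id b) *v y = (a \<bullet> b) *\<^sub>R mat 1 *v y"
    by (simp add: vec_eq_iff row_kron_id_mult_vec transpose_row_kron_id_mult_vec inner_vec_def
        sum_distrib_left mult_ac flip: matrix_vector_mul_assoc scaleR_matrix_vector_assoc
        del: transpose_matrix_vector)
qed

text \<open>A block row of the Kronecker product with the identity is \<open>row_kron_id\<close> of
  a column of \<open>B\<close>. All blocks of \<open>Sigma0\<close> thereby become covariances of
  linear maps under \<Sigma>.\<close>

lemma block_kron_congruence:
  fixes A :: "real^(2 \<times> 'k::finite)^(2 \<times> 'k)"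
  shows "block r s (kron (transpose B) (mat 1) ** A ** kron B (mat 1)) =
    row_kron_id (column r B) ** A ** transpose (row_kron_id (column s B))"
proof -
  have "kron (transpose B) (mat 1) $ (r, i) $ q = row_kron_id (column r B) $ i $ q" for i :: 'k and q
    by (simp add: kron_def row_kron_id_def transpose_def column_def)
  moreover have "kron B (mat 1) $ q $ (s, j) = transpose (row_kron_id (column s B)) $ q $ j" for j :: 'k and q
    by (simp add: kron_def row_kron_id_def transpose_def column_def mat_def)
  ultimately show ?thesis
    by (simp add: block_def vec_eq_iff matrix_matrix_mult_def)
qed

abbreviation second_axis :: "real^2" where
  "second_axis \<equiv> vector [0, 1]"

lemma column_B0_mat: "column 1 (B0_mat \<beta>\<^sub>0) = b0_vec \<beta>\<^sub>0" "column 2 (B0_mat \<beta>\<^sub>0) = second_axis"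
  by (simp_all add: B0_mat_def b0_vec_def column_def vec_eq_iff forall_2)

lemma Sigma_block_eq:
  "Sigma_block 1 1 \<beta>\<^sub>0 \<Sigma> = row_kron_id (b0_vec \<beta>\<^sub>0) ** \<Sigma> ** transpose (row_kron_id (b0_vec \<beta>\<^sub>0))"
  "Sigma_block 1 2 \<beta>\<^sub>0 \<Sigma> = row_kron_id (b0_vec \<beta>\<^sub>0) ** \<Sigma> ** transpose (row_kron_id second_axis)"
  "Sigma_block 2 1 \<beta>\<^sub>0 \<Sigma> = row_kron_id second_axis ** \<Sigma> ** transpose (row_kron_id (b0_vec \<beta>\<^sub>0))"
  "Sigma_block 2 2 \<beta>\<^sub>0 \<Sigma> = row_kron_id second_axis ** \<Sigma> ** transpose (row_kron_id second_axis)"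
  by (simp_all add: Sigma_block_def Sigma0_def block_kron_congruence column_B0_mat)

lemma b0_a0_inner:
  "a0_vec \<beta>\<^sub>0 \<bullet> b0_vec \<beta>\<^sub>0 = 0" "b0_vec \<beta>\<^sub>0 \<bullet> a0_vec \<beta>\<^sub>0 = 0" "second_axis \<bullet> a0_vec \<beta>\<^sub>0 = 1" "a0_vec \<beta>\<^sub>0 \<bullet> second_axis = 1"
  "b0_vec \<beta>\<^sub>0 \<bullet> vector [\<beta>s, 1] = \<beta>s - \<beta>\<^sub>0" "second_axis \<bullet> vector [\<beta>s, 1] = 1"
  by (simp_all add: inner_vec_def sum_2 a0_vec_def b0_vec_def)

text \<open>The vectors \<open>a0_vec\<close>, (1,0) and \<open>second_axis\<close>,
  \<open>b0_vec\<close> form a pair of dual bases of the plane, which resolves the identity.\<close>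

lemma row_kron_id_resolution:
  "transpose (row_kron_id second_axis) ** row_kron_id (a0_vec \<beta>\<^sub>0) +
   transpose (row_kron_id (b0_vec \<beta>\<^sub>0)) ** row_kron_id (vector [1, 0]) = (mat 1 :: real^(2 \<times> 'k::finite)^(2 \<times> 'k))"
  unfolding matrix_eq
proof
  fix x :: "real^(2 \<times> 'k)"
  have "second_axis $ r * (\<Sum>s\<in>UNIV. a0_vec \<beta>\<^sub>0 $ s * x $ (s, i)) +
      b0_vec \<beta>\<^sub>0 $ r * (\<Sum>s\<in>UNIV. vector [1, 0] $ s * x $ (s, i)) = x $ (r, i)" for r i
    using exhaust_2[of r] by (auto simp: sum_2 a0_vec_def b0_vec_def algebra_simps)
  then show "(transpose (row_kron_id second_axis) ** row_kron_id (a0_vec \<beta>\<^sub>0) +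
      transpose (row_kron_id (b0_vec \<beta>\<^sub>0)) ** row_kron_id (vector [1, 0])) *v x = mat 1 *v x"
    by (simp add: vec_eq_iff row_kron_id_mult_vec transpose_row_kron_id_mult_vec
        matrix_vector_mult_add_rdistrib flip: matrix_vector_mul_assoc del: transpose_matrix_vector)
qed

lemma vec_cols_rank_one_add:
  "vec_cols (\<chi> j l. m $ j * a $ l + X $ j $ l) = transpose (row_kron_id a) *v m + vec_cols X"
  by (simp add: vec_eq_iff vec_cols_def transpose_row_kron_id_mult_vec del: transpose_matrix_vector)

lemma crossprod_linear_model:
  assumes "\<And>i. i < n \<Longrightarrow> Y i = (Z i \<bullet> p) *\<^sub>R a + V i"
  shows "crossprod n Z Y = (\<chi> j l. (crossprod n Z Z *v p) $ j * a $ l + crossprod n Z V $ j $ l)"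
proof -
  have "(crossprod n Z Z *v p) $ j = (\<Sum>i<n. Z i $ j * (Z i \<bullet> p))" for j
    unfolding crossprod_def matrix_vector_mult_def inner_vec_def
    by (simp add: sum_distrib_left sum_distrib_right mult_ac) (rule sum.swap)
  then show ?thesis
    by (simp add: crossprod_def vec_eq_iff assms sum.distrib sum_distrib_left algebra_simps)
qed

text \<open>The signal keeps the form \<open>inv_msqrt\<close> times the cross product instead of
  \<open>msqrt\<close>, so that the identity also covers small \<open>n\<close>, for which the cross
  product is singular.\<close>

lemma vec_cols_R_stat:
  assumes "\<And>i. i < n \<Longrightarrow> Y i = (Z i \<bullet> p) *\<^sub>R a + V i"
  shows "vec_cols (R_stat n Z Y) =
    transpose (row_kron_id a) *v ((inv_msqrt (crossprod n Z Z) ** crossprod n Z Z) *v p) +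
    vec_cols (inv_msqrt (crossprod n Z Z) ** crossprod n Z V)"
proof -
  let ?B = "inv_msqrt (crossprod n Z Z)"
  have "crossprod n Z Y = (\<chi> j l. (crossprod n Z Z *v p) $ j * a $ l + crossprod n Z V $ j $ l)"
    using assms by (rule crossprod_linear_model)
  then have "?B ** crossprod n Z Y =
      (\<chi> j l. (?B *v (crossprod n Z Z *v p)) $ j * a $ l + (?B ** crossprod n Z V) $ j $ l)"
    by (simp add: vec_eq_iff matrix_matrix_mult_def matrix_vector_mult_def[of ?B] sum.distrib
        sum_distrib_left algebra_simps)
  then show ?thesis
    by (simp only: R_stat_def vec_cols_rank_one_add matrix_vector_mul_assoc)
qed

text \<open>The quadratic form is the sum of squares of the entries of \<open>Z x\<close>.\<close>

lemma crossprod_pos_def: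
  assumes "full_column_rank n Z"
  shows "pos_def (crossprod n Z Z)"
proof -
  have quad: "x \<bullet> (crossprod n Z Z *v x) = (\<Sum>i<n. (Z i \<bullet> x)\<^sup>2)" for x
  proof -
    have "crossprod n Z Z *v x = (\<Sum>i<n. (Z i \<bullet> x) *\<^sub>R Z i)"
      unfolding crossprod_def matrix_vector_mult_def inner_vec_def vec_eq_iff
      by (simp add: sum_distrib_left sum_distrib_right mult_ac) (intro allI sum.swap)
    then show ?thesis
      by (simp add: inner_sum_right power2_eq_square inner_commute)
  qed
  show ?thesis
    unfolding pos_def_def quad
  proof (intro conjI allI impI)
    show "transpose (crossprod n Z Z) = crossprod n Z Z"
      by (simp add: crossprod_def transpose_def vec_eq_iff mult.commute)
    fix x :: "real^'a" assume "x \<noteq> 0"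
    then obtain i where "i < n" "Z i \<bullet> x \<noteq> 0"
      using assms unfolding full_column_rank_def by blast
    then show "0 < (\<Sum>i<n. (Z i \<bullet> x)\<^sup>2)"
      by (intro sum_pos2[of _ i]) auto
  qed
qed

text \<open>The right-hand side, unlike the left-hand side, extends continuously to \<open>1 / s = 0\<close>.\<close>

lemma normalized_ratio_expansion:
  fixes a m q y :: "'v::real_inner" and s \<Delta> :: real
  defines "u \<equiv> a + (1 / s) *\<^sub>R q"
  assumes s: "s > 0" and a: "a \<noteq> 0" and u: "u \<noteq> 0"
  shows "((s * \<Delta>) *\<^sub>R m + y) \<bullet> (s *\<^sub>R a + q) / norm (s *\<^sub>R a + q) - s * \<Delta> * (m \<bullet> a) / norm a =
    y \<bullet> u / norm u + \<Delta> * (m \<bullet> q / norm u -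
      (2 * (a \<bullet> q) + (1 / s) * (q \<bullet> q)) / ((norm u + norm a) * norm a * norm u) * (m \<bullet> a))"
proof -
  have su: "s *\<^sub>R a + q = s *\<^sub>R u"
    using s by (simp add: u_def scaleR_add_right)
  have pos: "norm u > 0" "norm a > 0" "norm u + norm a \<noteq> 0"
    using a u by (auto simp: add_nonneg_eq_0_iff)
  \<comment> \<open>Rationalizing the difference of the norms: \<open>s * (norm u - norm a)\<close>,
    a product of a large and a small factor, becomes a quotient that stays bounded.\<close>
  have "(norm u)\<^sup>2 - (norm a)\<^sup>2 = (1 / s) * (2 * (a \<bullet> q) + (1 / s) * (q \<bullet> q))"
    unfolding u_def power2_norm_eq_inner
    by (simp add: inner_add inner_commute algebra_simps power2_eq_square add_divide_distrib)
  then have "2 * (a \<bullet> q) + (1 / s) * (q \<bullet> q) = s * (norm u - norm a) * (norm u + norm a)"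
    using s by (simp add: field_simps power2_eq_square)
  then have "(2 * (a \<bullet> q) + (1 / s) * (q \<bullet> q)) / ((norm u + norm a) * norm a * norm u) * (m \<bullet> a) =
      s * (norm u - norm a) / (norm a * norm u) * (m \<bullet> a)"
    using pos by simp
  also have "\<dots> = s * (m \<bullet> a) / norm a - s * (m \<bullet> a) / norm u"
    using pos by (simp add: field_simps)
  finally have correction: "(2 * (a \<bullet> q) + (1 / s) * (q \<bullet> q)) / ((norm u + norm a) * norm a * norm u) * (m \<bullet> a) =
      s * (m \<bullet> a) / norm a - s * (m \<bullet> a) / norm u" .
  have "((s * \<Delta>) *\<^sub>R m + y) \<bullet> (s *\<^sub>R a + q) / norm (s *\<^sub>R a + q) =
      (((s * \<Delta>) *\<^sub>R m + y) \<bullet> u) / norm u"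
    using s unfolding su by simp
  also have "\<dots> = s * \<Delta> * (m \<bullet> u) / norm u + y \<bullet> u / norm u"
    by (simp add: inner_add_left add_divide_distrib)
  also have "m \<bullet> u = m \<bullet> a + m \<bullet> q / s"
    by (simp add: u_def inner_add_right)
  finally have "((s * \<Delta>) *\<^sub>R m + y) \<bullet> (s *\<^sub>R a + q) / norm (s *\<^sub>R a + q) =
      s * \<Delta> * (m \<bullet> a) / norm u + \<Delta> * (m \<bullet> q) / norm u + y \<bullet> u / norm u"
    using s by (simp add: add_divide_distrib distrib_left)
  then show ?thesis
    unfolding correction by (simp add: algebra_simps)
qed

text \<open>The bracket in the limit is, up to the factor \<open>1 / norm a0\<close>, the derivative
  of \<open>x / norm x\<close> at \<open>a0\<close> in direction \<open>q0\<close>, paired with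
  \<open>m0\<close>. It arises because the main term of size \<open>s\<close> multiplies a change of
  direction of size \<open>1 / s\<close>.\<close>

lemma tendsto_normalized_ratio:
  fixes a m q y :: "'i \<Rightarrow> 'v::real_inner" and s :: "'i \<Rightarrow> real"
  assumes s: "filterlim s at_top F" and lim: "(a \<longlongrightarrow> a0) F" "(m \<longlongrightarrow> m0) F" "(q \<longlongrightarrow> q0) F" "(y \<longlongrightarrow> y0) F"
    and a0: "a0 \<noteq> 0"
  shows "((\<lambda>i. ((s i * \<Delta>) *\<^sub>R m i + y i) \<bullet> (s i *\<^sub>R a i + q i) / norm (s i *\<^sub>R a i + q i) -
      s i * \<Delta> * (m i \<bullet> a i) / norm (a i)) \<longlongrightarrow>
    y0 \<bullet> a0 / norm a0 + \<Delta> / norm a0 * (m0 \<bullet> q0 - (a0 \<bullet> q0) / (norm a0)\<^sup>2 * (m0 \<bullet> a0))) F"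
proof -
  define u where "u i = a i + (1 / s i) *\<^sub>R q i" for i
  have inv_s: "((\<lambda>i. 1 / s i) \<longlongrightarrow> 0) F"
    using tendsto_inverse_0_at_top[OF s] by (simp add: inverse_eq_divide)
  have u: "(u \<longlongrightarrow> a0) F"
    unfolding u_def using tendsto_add[OF lim(1) tendsto_scaleR[OF inv_s lim(3)]] by simp
  have "((\<lambda>i. y i \<bullet> u i / norm (u i) + \<Delta> * (m i \<bullet> q i / norm (u i) -
      (2 * (a i \<bullet> q i) + (1 / s i) * (q i \<bullet> q i)) / ((norm (u i) + norm (a i)) * norm (a i) * norm (u i)) * (m i \<bullet> a i))) \<longlongrightarrow>
      y0 \<bullet> a0 / norm a0 + \<Delta> * (m0 \<bullet> q0 / norm a0 -
      (2 * (a0 \<bullet> q0) + 0 * (q0 \<bullet> q0)) / ((norm a0 + norm a0) * norm a0 * norm a0) * (m0 \<bullet> a0))) F"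
    using a0 by (intro tendsto_intros u lim inv_s) auto
  also have "y0 \<bullet> a0 / norm a0 + \<Delta> * (m0 \<bullet> q0 / norm a0 -
      (2 * (a0 \<bullet> q0) + 0 * (q0 \<bullet> q0)) / ((norm a0 + norm a0) * norm a0 * norm a0) * (m0 \<bullet> a0)) =
      y0 \<bullet> a0 / norm a0 + \<Delta> / norm a0 * (m0 \<bullet> q0 - (a0 \<bullet> q0) / (norm a0)\<^sup>2 * (m0 \<bullet> a0))"
    using a0 by (simp add: field_simps power2_eq_square)
  finally have lim': "((\<lambda>i. y i \<bullet> u i / norm (u i) + \<Delta> * (m i \<bullet> q i / norm (u i) -
      (2 * (a i \<bullet> q i) + (1 / s i) * (q i \<bullet> q i)) / ((norm (u i) + norm (a i)) * norm (a i) * norm (u i)) * (m i \<bullet> a i))) \<longlongrightarrow>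
      y0 \<bullet> a0 / norm a0 + \<Delta> / norm a0 * (m0 \<bullet> q0 - (a0 \<bullet> q0) / (norm a0)\<^sup>2 * (m0 \<bullet> a0))) F" .
  have "\<forall>\<^sub>F i in F. s i > 0" "\<forall>\<^sub>F i in F. a i \<noteq> 0" "\<forall>\<^sub>F i in F. u i \<noteq> 0"
    using s lim(1) u a0 by (auto simp: filterlim_at_top_dense intro: tendsto_imp_eventually_ne)
  then have "\<forall>\<^sub>F i in F. y i \<bullet> u i / norm (u i) + \<Delta> * (m i \<bullet> q i / norm (u i) -
      (2 * (a i \<bullet> q i) + (1 / s i) * (q i \<bullet> q i)) / ((norm (u i) + norm (a i)) * norm (a i) * norm (u i)) * (m i \<bullet> a i)) =
      ((s i * \<Delta>) *\<^sub>R m i + y i) \<bullet> (s i *\<^sub>R a i + q i) / norm (s i *\<^sub>R a i + q i) -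
      s i * \<Delta> * (m i \<bullet> a i) / norm (a i)"
  proof eventually_elim
    case (elim i)
    then show ?case
      unfolding u_def by (intro normalized_ratio_expansion[symmetric])
  qed
  with lim' show ?thesis
    by (rule Lim_transform_eventually)
qed

section \<open>Auxiliary matrix facts and the residual of the second error block\<close>

lemma matrix_diff_ldistrib: "A ** (B - C) = A ** B - A ** C"
  and matrix_diff_rdistrib: "(B' - C') ** A' = B' ** A' - C' ** A'"
  for A :: "real^'n^'m" and A' :: "real^'n^'m"
  by (simp_all add: matrix_matrix_mult_def vec_eq_iff sum_subtractf algebra_simps)

lemma transpose_diff: "transpose (A - B) = transpose A - transpose B" for A :: "real^'n^'m"
  by (simp add: transpose_def vec_eq_iff)

text \<open>The left inverse \<open>L\<close> makes \<open>transpose K\<close> injective.\<close>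

lemma pos_def_congruence:
  fixes A :: "real^'n^'n" and K :: "real^'n^'m"
  assumes A: "pos_def A" and L: "L ** transpose K = mat 1"
  shows "pos_def (K ** A ** transpose K)"
  unfolding pos_def_def
proof (intro conjI allI impI)
  show "transpose (K ** A ** transpose K) = K ** A ** transpose K"
    using A by (simp add: matrix_transpose_mul matrix_mul_assoc pos_def_def)
  fix x :: "real^'m" assume "x \<noteq> 0"
  then have "transpose K *v x \<noteq> 0"
    using L by (metis matrix_vector_mul_assoc matrix_vector_mul_lid matrix_vector_mult_0_right)
  moreover have "x \<bullet> (K ** A ** transpose K *v x) = (transpose K *v x) \<bullet> (A *v (transpose K *v x))"
    by (simp only: inner_matrix_vector[of x K, symmetric] matrix_vector_mul_assoc[symmetric])
  ultimately show "0 < x \<bullet> (K ** A ** transpose K *v x)"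
    using A unfolding pos_def_def by metis
qed

text \<open>\<open>residual_map\<close> maps the stacked columns of the errors to the residual of the second
  block after projecting out the first, under the covariance \<open>Sigma0\<close>.\<close>

definition residual_map :: "real \<Rightarrow> real^(2 \<times> 'k::finite)^(2 \<times> 'k) \<Rightarrow> real^(2 \<times> 'k)^'k" where
  "residual_map \<beta>\<^sub>0 \<Sigma> = row_kron_id second_axis -
     Sigma_block 2 1 \<beta>\<^sub>0 \<Sigma> ** matrix_inv (Sigma_block 1 1 \<beta>\<^sub>0 \<Sigma>) ** row_kron_id (b0_vec \<beta>\<^sub>0)"

text \<open>The covariance of the residual, by \<open>residual_covariance\<close>, and therefore
  named apart from its inverse \<open>Sigma_sup22\<close>.\<close>

definition schur_complement :: "real \<Rightarrow> real^(2 \<times> 'k::finite)^(2 \<times> 'k) \<Rightarrow> real^'k^'k" where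
  "schur_complement \<beta>\<^sub>0 \<Sigma> = Sigma_block 2 2 \<beta>\<^sub>0 \<Sigma> -
     Sigma_block 2 1 \<beta>\<^sub>0 \<Sigma> ** matrix_inv (Sigma_block 1 1 \<beta>\<^sub>0 \<Sigma>) ** Sigma_block 1 2 \<beta>\<^sub>0 \<Sigma>"

lemma Sigma_sup22_eq: "Sigma_sup22 \<beta>\<^sub>0 \<Sigma> = matrix_inv (schur_complement \<beta>\<^sub>0 \<Sigma>)"
  by (simp add: Sigma_sup22_def schur_complement_def)

text \<open>Used twice: \<open>a = a0_vec\<close> gives the identity, and the structural direction
  \<open>vector [\<beta>s, 1]\<close> gives the factor of \<mu> that appears in \<gamma>.\<close>

lemma residual_map_transpose_row_kron_id:
  "residual_map \<beta>\<^sub>0 \<Sigma> ** transpose (row_kron_id a) = (second_axis \<bullet> a) *\<^sub>R mat 1 -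
     (b0_vec \<beta>\<^sub>0 \<bullet> a) *\<^sub>R (Sigma_block 2 1 \<beta>\<^sub>0 \<Sigma> ** matrix_inv (Sigma_block 1 1 \<beta>\<^sub>0 \<Sigma>))"
  by (simp add: residual_map_def matrix_diff_rdistrib row_kron_id_mult_transpose matrix_scalar_ac
      scalar_matrix_assoc flip: matrix_mul_assoc)

lemma tendsto_matrix_vector_mult: "(f \<longlongrightarrow> l) F \<Longrightarrow> ((\<lambda>z. A *v f z) \<longlongrightarrow> A *v l) F"
  for A :: "real^'n^'m"
  by (rule bounded_linear.tendsto[OF matrix_vector_mul_bounded_linear])

lemma annihilator_mult_vec:
  fixes g x :: "real^'n"
  shows "annihilator g *v x = x - ((g \<bullet> x) / (norm g)\<^sup>2) *\<^sub>R g"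
proof -
  have "((columnvector g :: real^1^'n) ** rowvector g) *v x = (g \<bullet> x) *\<^sub>R g"
    by (simp add: vec_eq_iff matrix_vector_mult_def matrix_matrix_mult_def columnvector_def
        rowvector_def inner_vec_def sum_distrib_left sum_distrib_right mult_ac)
  then show ?thesis
    by (simp add: annihilator_def matrix_vector_mult_diff_rdistrib flip: scaleR_matrix_vector_assoc)
qed

lemma annihilator_transpose: "transpose (annihilator g) = annihilator g"
  by (simp add: annihilator_def transpose_diff transpose_scalar matrix_transpose_mul
      transpose_columnvector transpose_rowvector)

text \<open>The statistic in terms of the stacked columns of \<open>R\<close>, after the two
  standardizations around \<open>T\<close> have cancelled.\<close>

definition LM1_map :: "real \<Rightarrow> real^(2 \<times> 'k::finite)^(2 \<times> 'k) \<Rightarrow> real^(2 \<times> 'k) \<Rightarrow> real" where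
  "LM1_map \<beta>\<^sub>0 \<Sigma> y = (let Q = inv_msqrt (Sigma_block 1 1 \<beta>\<^sub>0 \<Sigma>); W = Q *v (residual_map \<beta>\<^sub>0 \<Sigma> *v y)
     in (Q *v (row_kron_id (b0_vec \<beta>\<^sub>0) *v y)) \<bullet> W / norm W)"

text \<open>The vector representing the linear limit of the centered statistic. The first summand
  carries the noise of \<open>S\<close> along \<gamma>. The second carries the noise of the
  direction vector \<open>W\<close>, through the derivative of \<open>x / norm x\<close> at
  \<gamma>.\<close>

definition limit_functional ::
    "real \<Rightarrow> real^(2 \<times> 'k::finite)^(2 \<times> 'k) \<Rightarrow> real^'k^'k \<Rightarrow> real \<Rightarrow> real^'k \<Rightarrow> real^(2 \<times> 'k)" where
  "limit_functional \<beta>\<^sub>0 \<Sigma> D \<Delta> p =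
     (let g = gamma_vec \<beta>\<^sub>0 \<Sigma> D \<Delta> p; Q = inv_msqrt (Sigma_block 1 1 \<beta>\<^sub>0 \<Sigma>) in
     transpose (row_kron_id (b0_vec \<beta>\<^sub>0)) *v ((1 / norm g) *\<^sub>R (Q *v g)) +
     transpose (residual_map \<beta>\<^sub>0 \<Sigma>) *v
       ((\<Delta> / norm g) *\<^sub>R (Q *v (annihilator g *v (Q *v (msqrt D *v p))))))"

section \<open>Covariance algebra for a positive definite \<Sigma>\<close>

context
  fixes \<beta>\<^sub>0 :: real and \<Sigma> :: "real^(2 \<times> 'k::finite)^(2 \<times> 'k)"
  assumes \<Sigma>: "pos_def \<Sigma>"
begin

private abbreviation (input) "G \<equiv> (row_kron_id :: real^2 \<Rightarrow> real^(2 \<times> 'k)^'k)"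
private abbreviation (input) "b \<equiv> b0_vec \<beta>\<^sub>0"
private abbreviation (input) "S11 \<equiv> Sigma_block 1 1 \<beta>\<^sub>0 \<Sigma>"
private abbreviation (input) "S12 \<equiv> Sigma_block 1 2 \<beta>\<^sub>0 \<Sigma>"
private abbreviation (input) "S21 \<equiv> Sigma_block 2 1 \<beta>\<^sub>0 \<Sigma>"
private abbreviation (input) "Q \<equiv> inv_msqrt S11"
private abbreviation (input) "H \<equiv> residual_map \<beta>\<^sub>0 \<Sigma>"
private abbreviation (input) "C \<equiv> schur_complement \<beta>\<^sub>0 \<Sigma>"

lemma Sigma11_pos_def: "pos_def S11"
  unfolding Sigma_block_eq
  by (rule pos_def_congruence[OF \<Sigma>, of "row_kron_id (vector [1, 0])"])
    (simp add: row_kron_id_mult_transpose inner_vec_def sum_2 b0_vec_def)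

private lemma S11_inv: "matrix_inv S11 ** S11 = mat 1" "S11 ** matrix_inv S11 = mat 1"
  using Sigma11_pos_def by (simp_all add: matrix_inv_left matrix_inv_right pos_def_invertible)

lemma Sigma12_transpose: "transpose S21 = S12"
  using \<Sigma> by (simp add: Sigma_block_eq matrix_transpose_mul matrix_mul_assoc pos_def_def)

text \<open>The normal equations of regressing the second block on the first.\<close>

lemma residual_uncorrelated: "H ** \<Sigma> ** transpose (G b) = 0"
proof -
  have "H ** \<Sigma> ** transpose (G b) = S21 - S21 ** (matrix_inv S11 ** S11)"
    by (simp add: residual_map_def matrix_diff_rdistrib Sigma_block_eq(1,3) matrix_mul_assoc)
  then show ?thesis
    by (simp add: S11_inv)
qed

lemma residual_second_block: "H ** \<Sigma> ** transpose (G second_axis) = C"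
  by (simp add: residual_map_def matrix_diff_rdistrib schur_complement_def Sigma_block_eq(2,4)
      matrix_mul_assoc)

lemma residual_covariance: "H ** \<Sigma> ** transpose H = C"
proof -
  have "transpose H = transpose (G second_axis) - transpose (G b) ** transpose (S21 ** matrix_inv S11)"
    by (simp add: residual_map_def transpose_diff matrix_transpose_mul matrix_mul_assoc)
  then have "H ** \<Sigma> ** transpose H = H ** \<Sigma> ** transpose (G second_axis) -
      H ** \<Sigma> ** transpose (G b) ** transpose (S21 ** matrix_inv S11)"
    by (simp add: matrix_diff_ldistrib matrix_mul_assoc)
  then show ?thesis
    by (simp add: residual_uncorrelated residual_second_block)
qed

text \<open>As a covariance \<open>C\<close> is a congruence of \<Sigma>, and \<open>H\<close> has a
  right inverse built from \<open>a0_vec\<close>, which is orthogonal to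
  \<open>b0_vec\<close>.\<close>

lemma schur_complement_pos_def: "pos_def C"
proof -
  have "H ** transpose (G (a0_vec \<beta>\<^sub>0)) = mat 1"
    by (simp add: residual_map_transpose_row_kron_id b0_a0_inner)
  then have "G (a0_vec \<beta>\<^sub>0) ** transpose H = mat 1"
    by (metis matrix_transpose_mul transpose_mat transpose_transpose)
  then show ?thesis
    using pos_def_congruence[OF \<Sigma>] by (metis residual_covariance)
qed

private lemma C_inv: "matrix_inv C ** C = mat 1" "C ** matrix_inv C = mat 1"
  using schur_complement_pos_def by (simp_all add: matrix_inv_left matrix_inv_right pos_def_invertible)

text \<open>Block inversion without inverting blocks of \<Sigma> explicitly: inserting the
  resolution of the identity after \<open>H ** \<Sigma>\<close>, the \<open>b0_vec\<close> part
  drops out by uncorrelatedness and \<open>C\<close> times the \<open>a0_vec\<close> part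
  remains.\<close>

lemma row_kron_id_a0_precision: "G (a0_vec \<beta>\<^sub>0) ** matrix_inv \<Sigma> = matrix_inv C ** H"
proof -
  have "H ** \<Sigma> = H ** \<Sigma> ** (transpose (G second_axis) ** G (a0_vec \<beta>\<^sub>0) +
      transpose (G b) ** row_kron_id (vector [1, 0]))"
    by (simp add: row_kron_id_resolution)
  also have "\<dots> = C ** G (a0_vec \<beta>\<^sub>0)"
    by (simp add: matrix_add_ldistrib matrix_mul_assoc residual_second_block residual_uncorrelated)
  finally have "H ** (\<Sigma> ** matrix_inv \<Sigma>) = C ** G (a0_vec \<beta>\<^sub>0) ** matrix_inv \<Sigma>"
    by (simp add: matrix_mul_assoc)
  then have "matrix_inv C ** H = (matrix_inv C ** C) ** G (a0_vec \<beta>\<^sub>0) ** matrix_inv \<Sigma>"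
    using \<Sigma> by (simp add: matrix_inv_right pos_def_invertible flip: matrix_mul_assoc)
  then show ?thesis
    by (simp add: C_inv)
qed

text \<open>By \<open>row_kron_id_a0_precision\<close>, \<open>T\<close> is an inverse root of
  \<open>matrix_inv C\<close> applied to \<open>matrix_inv C ** H\<close>. The factor in front of
  \<open>T\<close> supplies the same inverse root once more, and together they cancel
  \<open>matrix_inv C\<close>.\<close>

lemma LM1_stat_eq: "LM1_stat \<beta>\<^sub>0 \<Sigma> R = LM1_map \<beta>\<^sub>0 \<Sigma> (vec_cols R)"
proof -
  let ?P = "inv_msqrt (matrix_inv C)"
  have "G (a0_vec \<beta>\<^sub>0) ** matrix_inv \<Sigma> ** transpose (G (a0_vec \<beta>\<^sub>0)) = matrix_inv C"
    unfolding row_kron_id_a0_precision matrix_mul_assoc[symmetric]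
    by (simp add: residual_map_transpose_row_kron_id b0_a0_inner)
  then have T: "T_stat \<beta>\<^sub>0 \<Sigma> R = ?P *v ((matrix_inv C ** H) *v vec_cols R)"
    by (simp add: T_stat_def row_kron_id_a0_precision)
  have "?P ** ?P ** matrix_inv C = mat 1"
    by (intro inv_msqrt_mult(2) matrix_inv_pos_def schur_complement_pos_def)
  then have "?P *v (?P *v (matrix_inv C *v y)) = y" for y
    by (simp add: matrix_vector_mul_assoc matrix_mul_assoc)
  then have "(Q ** inv_msqrt (Sigma_sup22 \<beta>\<^sub>0 \<Sigma>)) *v T_stat \<beta>\<^sub>0 \<Sigma> R = Q *v (H *v vec_cols R)"
    by (simp add: T Sigma_sup22_eq flip: matrix_vector_mul_assoc)
  moreover have "S_stat \<beta>\<^sub>0 \<Sigma> R = Q *v (G b *v vec_cols R)"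
    by (simp only: S_stat_def Sigma_block_eq)
  ultimately show ?thesis
    by (simp add: LM1_stat_def LM1_map_def Let_def)
qed

section \<open>Centering term and limiting linear functional\<close>

private lemma Q_facts: "transpose Q = Q" "Q ** Q = matrix_inv S11" "Q ** S11 ** Q = mat 1"
proof -
  show "transpose Q = Q"
    using inv_msqrt_pos_def[OF Sigma11_pos_def] by (simp add: pos_def_def)
  show "Q ** Q = matrix_inv S11"
    by (rule inv_msqrt_square[OF Sigma11_pos_def])
  show "Q ** S11 ** Q = mat 1"
    using inv_msqrt_mult(2)[OF Sigma11_pos_def] by (metis matrix_left_right_inverse matrix_mul_assoc)
qed

private abbreviation (input) "K \<Delta> \<equiv> mat 1 - \<Delta> *\<^sub>R (S21 ** matrix_inv S11)"

text \<open>Splitting the inverse of \<open>S11\<close> as \<open>Q ** Q\<close> shows that the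
  centering is the value of the statistic at zero errors.\<close>

lemma c_shift_eq:
  "c_shift \<beta>\<^sub>0 \<Sigma> \<Delta> \<mu> = \<Delta> * ((Q *v \<mu>) \<bullet> (Q *v (K \<Delta> *v \<mu>))) / norm (Q *v (K \<Delta> *v \<mu>))"
proof -
  have QQ: "(Q *v x) \<bullet> (Q *v y) = x \<bullet> (matrix_inv S11 *v y)" for x y
    using inner_matrix_vector[of x Q "Q *v y"]
    by (simp add: Q_facts(1,2) matrix_vector_mul_assoc del: transpose_matrix_vector)
  have Kmu: "matrix_inv S11 *v (K \<Delta> *v \<mu>) = matrix_inv S11 *v \<mu> -
      \<Delta> *\<^sub>R ((matrix_inv S11 ** S21 ** matrix_inv S11) *v \<mu>)"
    by (simp add: matrix_vector_mult_diff_rdistrib matrix_vector_mult_diff_distrib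
        matrix_vector_mult_scaleR matrix_vector_mul_assoc matrix_mul_assoc
        flip: scaleR_matrix_vector_assoc)
  have num: "\<Delta> * ((Q *v \<mu>) \<bullet> (Q *v (K \<Delta> *v \<mu>))) = \<Delta> * (\<mu> \<bullet> (matrix_inv S11 *v \<mu>)) -
      \<Delta>\<^sup>2 * (\<mu> \<bullet> ((matrix_inv S11 ** S21 ** matrix_inv S11) *v \<mu>))"
    unfolding QQ Kmu by (simp add: inner_diff_right power2_eq_square right_diff_distrib)
  have "transpose (matrix_inv S11) = matrix_inv S11"
    using matrix_inv_pos_def[OF Sigma11_pos_def] by (simp add: pos_def_def)
  then have K_transpose: "transpose (K \<Delta>) = mat 1 - \<Delta> *\<^sub>R (matrix_inv S11 ** S12)"
    by (simp add: transpose_diff transpose_scalar matrix_transpose_mul Sigma12_transpose)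
  have "\<mu> \<bullet> (((mat 1 - \<Delta> *\<^sub>R (matrix_inv S11 ** S12)) ** matrix_inv S11 ** K \<Delta>) *v \<mu>) =
      (K \<Delta> *v \<mu>) \<bullet> (matrix_inv S11 *v (K \<Delta> *v \<mu>))"
    by (simp only: K_transpose[symmetric] matrix_vector_mul_assoc[symmetric]
        inner_matrix_vector[of \<mu> "transpose (K \<Delta>)"] transpose_transpose)
  also have "\<dots> = (norm (Q *v (K \<Delta> *v \<mu>)))\<^sup>2"
    by (simp only: QQ[symmetric] power2_norm_eq_inner)
  finally have "sqrt (\<mu> \<bullet> (((mat 1 - \<Delta> *\<^sub>R (matrix_inv S11 ** S12)) ** matrix_inv S11 ** K \<Delta>) *v \<mu>)) =
      norm (Q *v (K \<Delta> *v \<mu>))"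
    by simp
  then show ?thesis
    by (simp add: c_shift_def num Let_def)
qed

text \<open>Puts the functional into the form of the limit in
  \<open>tendsto_normalized_ratio\<close>.\<close>

lemma limit_functional_inner:
  fixes x :: "real^(2 \<times> 'k)" and D :: "real^'k^'k" and p :: "real^'k" and \<Delta> :: real
  defines "g \<equiv> gamma_vec \<beta>\<^sub>0 \<Sigma> D \<Delta> p"
  defines "m0 \<equiv> Q *v (msqrt D *v p)" and "q0 \<equiv> Q *v (H *v x)"
  shows "limit_functional \<beta>\<^sub>0 \<Sigma> D \<Delta> p \<bullet> x =
    (Q *v (G b *v x)) \<bullet> g / norm g + \<Delta> / norm g * (m0 \<bullet> q0 - (g \<bullet> q0) / (norm g)\<^sup>2 * (m0 \<bullet> g))"
proof -
  have Q: "(Q *v y) \<bullet> z = y \<bullet> (Q *v z)" for y z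
    using inner_matrix_vector[of y Q z] by (simp add: Q_facts(1) del: transpose_matrix_vector)
  have "limit_functional \<beta>\<^sub>0 \<Sigma> D \<Delta> p \<bullet> x =
      ((1 / norm g) *\<^sub>R (Q *v g)) \<bullet> (G b *v x) +
      ((\<Delta> / norm g) *\<^sub>R (Q *v (annihilator g *v m0))) \<bullet> (H *v x)"
    unfolding limit_functional_def Let_def g_def[symmetric] m0_def[symmetric]
    by (simp only: inner_add_left inner_matrix_vector)
  also have "\<dots> = g \<bullet> (Q *v (G b *v x)) / norm g + \<Delta> / norm g * ((annihilator g *v m0) \<bullet> q0)"
    by (simp add: Q q0_def)
  also have "(annihilator g *v m0) \<bullet> q0 = m0 \<bullet> q0 - (g \<bullet> q0) / (norm g)\<^sup>2 * (m0 \<bullet> g)"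
    by (simp add: annihilator_mult_vec inner_diff_left inner_commute[of m0 g])
  finally show ?thesis
    by (simp only: inner_commute[of g "Q *v (G b *v x)"])
qed

text \<open>The two summands are uncorrelated. The first has variance 1 because \<open>Q\<close>
  standardizes \<open>S11\<close>, and the second contributes a nonnegative form in
  \<open>C\<close>, so the total is at least 1.\<close>

lemma limit_functional_variance:
  assumes g: "gamma_vec \<beta>\<^sub>0 \<Sigma> D \<Delta> p \<noteq> 0" and D: "pos_def D"
  shows "limit_functional \<beta>\<^sub>0 \<Sigma> D \<Delta> p \<bullet> (\<Sigma> *v limit_functional \<beta>\<^sub>0 \<Sigma> D \<Delta> p) =
      limit_variance \<beta>\<^sub>0 \<Sigma> D \<Delta> p" (is ?eq)
    and "limit_variance \<beta>\<^sub>0 \<Sigma> D \<Delta> p > 0" (is ?pos)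
proof -
  define g where "g = gamma_vec \<beta>\<^sub>0 \<Sigma> D \<Delta> p"
  define m0 where "m0 = Q *v (msqrt D *v p)"
  define u where "u = (1 / norm g) *\<^sub>R (Q *v g)"
  define w where "w = Q *v (annihilator g *v m0)"
  define c where "c = \<Delta> / norm g"
  let ?l = "transpose (G b) *v u + transpose H *v (c *\<^sub>R w)"
  have l: "limit_functional \<beta>\<^sub>0 \<Sigma> D \<Delta> p = ?l"
    by (simp only: limit_functional_def Let_def u_def w_def m0_def g_def c_def)
  have norm_g: "norm g > 0"
    using g by (simp add: g_def)
  have Q: "(Q *v y) \<bullet> z = y \<bullet> (Q *v z)" for y z
    using inner_matrix_vector[of y Q z] by (simp add: Q_facts(1) del: transpose_matrix_vector)
  have sym: "transpose \<Sigma> = \<Sigma>"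
    using \<Sigma> by (simp add: pos_def_def)
  have expand: "(transpose A *v y) \<bullet> (\<Sigma> *v (transpose B *v z)) = y \<bullet> ((A ** \<Sigma> ** transpose B) *v z)"
    for A B :: "real^(2 \<times> 'k)^'k" and y z
    by (simp only: inner_matrix_vector[symmetric] matrix_vector_mul_assoc matrix_mul_assoc)
  have "u \<bullet> ((G b ** \<Sigma> ** transpose (G b)) *v u) = u \<bullet> (S11 *v u)"
    by (simp only: Sigma_block_eq)
  also have "\<dots> = (g \<bullet> ((Q ** S11 ** Q) *v g)) / (norm g)\<^sup>2"
    by (simp add: u_def matrix_vector_mult_scaleR Q power2_eq_square flip: matrix_vector_mul_assoc)
  also have "\<dots> = 1"
    using norm_g by (simp add: Q_facts(3) power2_norm_eq_inner[symmetric])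
  finally have uu: "u \<bullet> ((G b ** \<Sigma> ** transpose (G b)) *v u) = 1" .
  let ?x = "transpose (G b) *v u" and ?y = "transpose H *v (c *\<^sub>R w)"
  have "(?x + ?y) \<bullet> (\<Sigma> *v (?x + ?y)) =
      ?x \<bullet> (\<Sigma> *v ?x) + 2 * (?y \<bullet> (\<Sigma> *v ?x)) + ?y \<bullet> (\<Sigma> *v ?y)"
    using inner_symmetric_matrix[OF sym, of ?x ?y]
    by (simp add: inner_add matrix_vector_right_distrib del: transpose_matrix_vector)
  then have ll: "?l \<bullet> (\<Sigma> *v ?l) = 1 + c\<^sup>2 * (w \<bullet> (C *v w))"
    unfolding expand uu residual_uncorrelated residual_covariance
    by (simp add: matrix_vector_mult_scaleR power2_eq_square)
  have "transpose (annihilator g) = annihilator g" "transpose (msqrt D) = msqrt D"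
    using msqrt_pos_def[OF D] by (simp_all add: annihilator_transpose pos_def_def)
  then have move: "(annihilator g *v y) \<bullet> z = y \<bullet> (annihilator g *v z)" "(msqrt D *v y) \<bullet> z = y \<bullet> (msqrt D *v z)"
    for y z
    using inner_matrix_vector[of y "annihilator g" z] inner_matrix_vector[of y "msqrt D" z]
    by (simp_all del: transpose_matrix_vector)
  have "matrix_inv (Sigma_sup22 \<beta>\<^sub>0 \<Sigma>) = C"
    unfolding Sigma_sup22_eq by (rule matrix_inv_eqI) (rule C_inv)
  then have "limit_variance \<beta>\<^sub>0 \<Sigma> D \<Delta> p = 1 + c\<^sup>2 * (w \<bullet> (C *v w))"
    unfolding limit_variance_def Let_def g_def[symmetric]
    by (simp add: w_def m0_def Q move c_def power_divide flip: matrix_vector_mul_assoc)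
  moreover have "w \<bullet> (C *v w) \<ge> 0"
    using pos_def_imp_pos_semidef[OF schur_complement_pos_def] by (simp add: pos_semidef_def)
  ultimately show ?eq ?pos
    unfolding l ll by (simp_all add: add_pos_nonneg)
qed

text \<open>Here \<open>s\<close> plays the role of the root of the sample size and \<open>w\<close>
  that of \<mu> divided by it. The product filter expresses convergence along all sequences of
  arguments tending to \<open>x\<close>.\<close>

lemma LM1_map_continuous_convergence:
  fixes w :: "nat \<Rightarrow> real^'k" and s :: "nat \<Rightarrow> real"
  assumes w: "w \<longlonglongrightarrow> msqrt D *v p" and s: "filterlim s at_top sequentially"
    and \<Delta>: "\<Delta> = \<beta>s - \<beta>\<^sub>0" and g: "gamma_vec \<beta>\<^sub>0 \<Sigma> D \<Delta> p \<noteq> 0"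
  shows "((\<lambda>z. LM1_map \<beta>\<^sub>0 \<Sigma> (transpose (G (vector [\<beta>s, 1])) *v (s (fst z) *\<^sub>R w (fst z)) + snd z) -
      c_shift \<beta>\<^sub>0 \<Sigma> \<Delta> (s (fst z) *\<^sub>R w (fst z))) \<longlongrightarrow>
    limit_functional \<beta>\<^sub>0 \<Sigma> D \<Delta> p \<bullet> x) (sequentially \<times>\<^sub>F nhds x)"
proof -
  let ?F = "sequentially \<times>\<^sub>F nhds x"
  have fst: "filterlim fst sequentially ?F" and snd: "filterlim snd (nhds x) ?F"
    by (rule filterlim_fst, rule filterlim_snd)
  have gamma: "gamma_vec \<beta>\<^sub>0 \<Sigma> D \<Delta> p = Q *v (K \<Delta> *v (msqrt D *v p))"
    by (simp add: gamma_vec_def matrix_vector_mul_assoc matrix_mul_assoc)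
  have w': "((\<lambda>z. w (fst z)) \<longlongrightarrow> msqrt D *v p) ?F"
    by (rule filterlim_compose[OF w fst])
  have s': "filterlim (\<lambda>z. s (fst z)) at_top ?F"
    by (rule filterlim_compose[OF s fst])
  have first: "G b *v (transpose (G (vector [\<beta>s, 1])) *v y) = \<Delta> *\<^sub>R y" for y
    unfolding matrix_vector_mul_assoc row_kron_id_mult_transpose b0_a0_inner \<Delta>
    by (simp flip: scaleR_matrix_vector_assoc)
  have second: "H *v (transpose (G (vector [\<beta>s, 1])) *v y) = K \<Delta> *v y" for y
    unfolding matrix_vector_mul_assoc residual_map_transpose_row_kron_id b0_a0_inner \<Delta> by simp
  have "((\<lambda>z. ((s (fst z) * \<Delta>) *\<^sub>R (Q *v w (fst z)) + Q *v (G b *v snd z)) \<bullet>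
        (s (fst z) *\<^sub>R (Q *v (K \<Delta> *v w (fst z))) + Q *v (H *v snd z)) /
        norm (s (fst z) *\<^sub>R (Q *v (K \<Delta> *v w (fst z))) + Q *v (H *v snd z)) -
      s (fst z) * \<Delta> * ((Q *v w (fst z)) \<bullet> (Q *v (K \<Delta> *v w (fst z)))) / norm (Q *v (K \<Delta> *v w (fst z))))
    \<longlongrightarrow> limit_functional \<beta>\<^sub>0 \<Sigma> D \<Delta> p \<bullet> x) ?F"
    unfolding limit_functional_inner gamma
    by (intro tendsto_normalized_ratio s' tendsto_matrix_vector_mult w' snd) (use g in \<open>simp add: gamma\<close>)
  \<comment> \<open>The centering is homogeneous of degree one only for positive scalars, since its
    denominator is a norm.\<close>
  moreover have "\<forall>\<^sub>F z in ?F. s (fst z) > 0"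
    using s' by (simp add: filterlim_at_top_dense)
  then have "\<forall>\<^sub>F z in ?F. ((s (fst z) * \<Delta>) *\<^sub>R (Q *v w (fst z)) + Q *v (G b *v snd z)) \<bullet>
        (s (fst z) *\<^sub>R (Q *v (K \<Delta> *v w (fst z))) + Q *v (H *v snd z)) /
        norm (s (fst z) *\<^sub>R (Q *v (K \<Delta> *v w (fst z))) + Q *v (H *v snd z)) -
      s (fst z) * \<Delta> * ((Q *v w (fst z)) \<bullet> (Q *v (K \<Delta> *v w (fst z)))) / norm (Q *v (K \<Delta> *v w (fst z))) =
    LM1_map \<beta>\<^sub>0 \<Sigma> (transpose (G (vector [\<beta>s, 1])) *v (s (fst z) *\<^sub>R w (fst z)) + snd z) -
      c_shift \<beta>\<^sub>0 \<Sigma> \<Delta> (s (fst z) *\<^sub>R w (fst z))"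
    by eventually_elim
      (simp add: LM1_map_def Let_def c_shift_eq matrix_vector_right_distrib first second
        matrix_vector_mult_scaleR mult_ac del: transpose_matrix_vector)
  ultimately show ?thesis
    by (rule Lim_transform_eventually)
qed

end

section \<open>Measurability, Gaussian projections and the limit theorem\<close>

lemma borel_measurable_cart:
  fixes f :: "'a \<Rightarrow> real^'n"
  assumes "\<And>i. (\<lambda>x. f x $ i) \<in> borel_measurable M"
  shows "f \<in> borel_measurable M"
  by (rule borel_measurable_euclidean_space[THEN iffD2])
    (use assms in \<open>auto simp: Basis_vec_def inner_axis\<close>)

lemma borel_measurable_matrix_vector_mult: "(*v) A \<in> borel_measurable borel"
  for A :: "real^'n^'m"
  by (intro borel_measurable_continuous_onI linear_continuous_on matrix_vector_mul_bounded_linear)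

lemma borel_measurable_LM1_map: "LM1_map \<beta>\<^sub>0 \<Sigma> \<in> borel_measurable borel"
  unfolding LM1_map_def Let_def
  by (intro borel_measurable_divide borel_measurable_inner measurable_compose[OF _ borel_measurable_norm]
      measurable_compose[OF _ borel_measurable_matrix_vector_mult] measurable_ident_sets refl)

text \<open>Translating along \<open>\<Sigma> *v l\<close> tilts the density by the exponential of a
  multiple of \<open>l \<bullet> x\<close>, as \<open>gaussian_projection\<close> demands. The total
  mass comes from the assumption \<open>prob\<close>.\<close>

lemma multivariate_normal_projection:
  fixes \<Sigma> :: "real^'n^'n" and l :: "real^'n"
  assumes \<Sigma>: "pos_def \<Sigma>" and prob: "prob_space (multivariate_normal 0 \<Sigma>)" and v: "l \<bullet> (\<Sigma> *v l) > 0"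
  shows "distr (multivariate_normal 0 \<Sigma>) borel (\<lambda>x. l \<bullet> x) = normal_law 0 (l \<bullet> (\<Sigma> *v l))"
proof -
  let ?A = "matrix_inv \<Sigma>" and ?h = "\<Sigma> *v l"
  define c where "c = 1 / sqrt ((2 * pi) ^ CARD('n) * det \<Sigma>)"
  define p where "p x = ennreal (exp (- (x \<bullet> (?A *v x)) / 2) * c)" for x
  have law: "multivariate_normal 0 \<Sigma> = density lborel p"
    unfolding multivariate_normal_def
    by (rule arg_cong[where f = "density lborel"]) (simp add: p_def c_def fun_eq_iff)
  have [measurable]: "(\<lambda>x. ?A *v x) \<in> borel_measurable borel"
    by (rule borel_measurable_matrix_vector_mult)
  have p_meas: "p \<in> borel_measurable borel"
    unfolding p_def by measurable
  have sym: "transpose ?A = ?A"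
    using matrix_inv_pos_def[OF \<Sigma>] by (simp add: pos_def_def)
  have Ah: "?A *v ?h = l"
    using \<Sigma> by (simp add: matrix_vector_mul_assoc matrix_inv_left pos_def_invertible)
  show ?thesis
    unfolding law
  proof (rule gaussian_projection[OF p_meas _ _ refl v])
    show "(\<integral>\<^sup>+x. p x \<partial>lborel) = 1"
      using prob_space.emeasure_space_1[OF prob] p_meas by (simp add: law emeasure_density)
    fix s x
    have quad: "(x - s *\<^sub>R ?h) \<bullet> (?A *v (x - s *\<^sub>R ?h)) =
        x \<bullet> (?A *v x) - 2 * s * (l \<bullet> x) + s\<^sup>2 * (l \<bullet> ?h)"
    proof -
      have "?h \<bullet> (?A *v x) = l \<bullet> x"
        by (simp add: inner_symmetric_matrix[OF sym, of ?h x] Ah inner_commute[of x l])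
      then show ?thesis
        by (simp add: matrix_vector_mult_diff_distrib matrix_vector_mult_scaleR inner_diff Ah
            power2_eq_square inner_commute[of x l] inner_commute[of ?h l] right_diff_distrib)
    qed
    have "exp (- ((x - s *\<^sub>R ?h) \<bullet> (?A *v (x - s *\<^sub>R ?h))) / 2) =
        exp (- (x \<bullet> (?A *v x)) / 2) * exp (s * (l \<bullet> x) - s\<^sup>2 * (l \<bullet> ?h) / 2)"
      unfolding quad mult_exp_exp by (rule arg_cong[where f = exp]) (simp add: field_simps)
    then show "p (x - s *\<^sub>R ?h) = p x * ennreal (exp (s * (l \<bullet> x) - s\<^sup>2 * (l \<bullet> ?h) / 2))"
      by (simp add: p_def ennreal_mult''[symmetric] mult_ac)
  qed
qed

text \<open>The constant test function 1 settles the mass of the limit, which spares the evaluation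
  of the multivariate Gaussian integral.\<close>

lemma weakly_converges_prob_space:
  assumes N: "\<And>n. prob_space (N n)" and wc: "weakly_converges N L"
  shows "prob_space L"
proof
  have "(\<lambda>n. \<integral>x. (1 :: real) \<partial>N n) \<longlonglongrightarrow> (\<integral>x. 1 \<partial>L)"
    using wc[unfolded weakly_converges_def, rule_format, of "\<lambda>_. 1"] by simp
  then have "(\<lambda>n. 1) \<longlonglongrightarrow> measure L (space L)"
    by (simp add: prob_space.prob_space[OF N])
  then have "measure L (space L) = 1"
    by (rule LIMSEQ_unique[OF _ tendsto_const])
  \<comment> \<open>Infinite mass is excluded because \<open>measure\<close> would then be
    0.\<close>
  then show "emeasure L (space L) = 1"
    by (cases "emeasure L (space L)") (auto simp: measure_def)
qed

text \<open>Full column rank is asked from \<open>n = CARD('k)\<close> on, as fewer rows cannot have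
  it. The nonvanishing of \<gamma> gives meaning to the division by its squared norm in the
  variance.\<close>

theorem theorem2:
  fixes M :: "nat \<Rightarrow> 'a measure"
    and Z :: "nat \<Rightarrow> nat \<Rightarrow> real^'k"
    and V Y :: "nat \<Rightarrow> 'a \<Rightarrow> nat \<Rightarrow> real^2"
    and \<pi> :: "real^'k"
    and \<beta>s \<beta>\<^sub>0 \<Delta> :: real
    and D :: "real^'k^'k" and \<Omega> :: "real^2^2"
    and \<Sigma> :: "real^(2 \<times> 'k::finite)^(2 \<times> 'k)"
  assumes prob: "\<And>n. prob_space (M n)"
    and rank: "\<And>n. CARD('k) \<le> n \<Longrightarrow> full_column_rank n (Z n)"
    and V_integrable: "\<And>n i. i < n \<Longrightarrow> integrable (M n) (\<lambda>\<omega>. V n \<omega> i)"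
    and V_mean: "\<And>n i. i < n \<Longrightarrow> (\<integral>\<omega>. V n \<omega> i \<partial>M n) = 0"
    and model: "\<And>n \<omega> i. \<omega> \<in> space (M n) \<Longrightarrow> i < n \<Longrightarrow>
        Y n \<omega> i = (Z n i \<bullet> \<pi>) *\<^sub>R vector [\<beta>s, 1] + V n \<omega> i"
    and NA_a: "pos_def D" "(\<lambda>n. (1 / real n) *\<^sub>R crossprod n (Z n) (Z n)) \<longlonglongrightarrow> D"
    and NA_b: "pos_def \<Omega>"
      "tendsto_in_prob M (\<lambda>n \<omega>. (1 / real n) *\<^sub>R crossprod n (V n \<omega>) (V n \<omega>)) \<Omega>"
    and NA_c: "pos_def \<Sigma>"
      "weakly_converges
         (\<lambda>n. distr (M n) borel
            (\<lambda>\<omega>. vec_cols (inv_msqrt (crossprod n (Z n) (Z n)) ** crossprod n (Z n) (V n \<omega>))))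
         (multivariate_normal 0 \<Sigma>)"
    and Delta: "\<Delta> = \<beta>s - \<beta>\<^sub>0"
    and pi_nonzero: "\<pi> \<noteq> 0"
    and gamma_nonzero: "gamma_vec \<beta>\<^sub>0 \<Sigma> D \<Delta> \<pi> \<noteq> 0"
  shows "weak_conv_m
     (\<lambda>n. distr (M n) borel
        (\<lambda>\<omega>. LM1_stat \<beta>\<^sub>0 \<Sigma> (R_stat n (Z n) (Y n \<omega>)) -
              c_shift \<beta>\<^sub>0 \<Sigma> \<Delta> (msqrt (crossprod n (Z n) (Z n)) *v \<pi>)))
     (normal_law 0 (limit_variance \<beta>\<^sub>0 \<Sigma> D \<Delta> \<pi>))"
proof -
  interpret M: prob_space "M n" for n
    by (rule prob)
  define A where "A n = crossprod n (Z n) (Z n)" for n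
  define X where "X n \<omega> = vec_cols (inv_msqrt (A n) ** crossprod n (Z n) (V n \<omega>))" for n \<omega>
  \<comment> \<open>The mean as it comes out of \<open>R_stat\<close> for every \<open>n\<close>; it
    equals \<open>\<mu> n\<close> once the cross product is positive definite.\<close>
  define \<rho> where "\<rho> n = (inv_msqrt (A n) ** A n) *v \<pi>" for n
  define \<mu> where "\<mu> n = msqrt (A n) *v \<pi>" for n
  define w where "w n = msqrt ((1 / real n) *\<^sub>R A n) *v \<pi>" for n
  define l where "l = limit_functional \<beta>\<^sub>0 \<Sigma> D \<Delta> \<pi>"
  \<comment> \<open>The centered statistic as a deterministic function of the transformed errors, so
    that all randomness sits in \<open>X n\<close>.\<close>
  define F where "F n x = LM1_map \<beta>\<^sub>0 \<Sigma> (transpose (row_kron_id (vector [\<beta>s, 1])) *v \<rho> n + x) -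
      c_shift \<beta>\<^sub>0 \<Sigma> \<Delta> (\<mu> n)" for n x

  have X_meas: "X n \<in> borel_measurable (M n)" for n
  proof (rule borel_measurable_cart)
    have V_meas: "(\<lambda>\<omega>. V n \<omega> i $ j) \<in> borel_measurable (M n)" if "i < n" for i j
    proof -
      have "(\<lambda>\<omega>. V n \<omega> i \<bullet> axis j 1) \<in> borel_measurable (M n)"
        using V_integrable[OF that] by (intro borel_measurable_inner) auto
      then show ?thesis
        by (simp add: inner_axis)
    qed
    show "(\<lambda>\<omega>. X n \<omega> $ q) \<in> borel_measurable (M n)" for q
      unfolding X_def vec_cols_def matrix_matrix_mult_def crossprod_def
      by (simp, intro borel_measurable_sum borel_measurable_times borel_measurable_const V_meas) auto
  qed
  have F_meas: "F n \<in> borel_measurable borel" for n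
    unfolding F_def
    by (intro borel_measurable_diff measurable_compose[OF _ borel_measurable_LM1_map]
        borel_measurable_add borel_measurable_const measurable_ident_sets refl)
  have wc: "weakly_converges (\<lambda>n. distr (M n) borel (X n)) (multivariate_normal 0 \<Sigma>)"
    using NA_c(2) unfolding X_def A_def .
  have N: "prob_space (distr (M n) borel (X n))" for n
    by (intro M.prob_space_distr X_meas)
  have L: "prob_space (multivariate_normal 0 \<Sigma>)"
    by (rule weakly_converges_prob_space[OF N wc])

  have A_pd: "\<forall>\<^sub>F n in sequentially. n > 0 \<and> pos_def (A n)"
    unfolding A_def
    by (intro eventually_sequentiallyI[of "CARD('k)"] conjI crossprod_pos_def rank)
      (auto intro: less_le_trans[OF zero_less_card_finite[where 'a = 'k]])
  have "(\<lambda>n. (1 / real n) *\<^sub>R A n) \<longlonglongrightarrow> D"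
    using NA_a(2) by (simp add: A_def)
  moreover have "\<forall>\<^sub>F n in sequentially. pos_def ((1 / real n) *\<^sub>R A n)"
    using A_pd by eventually_elim
      (simp add: pos_def_def transpose_scalar flip: scaleR_matrix_vector_assoc)
  ultimately have "(\<lambda>n. msqrt ((1 / real n) *\<^sub>R A n)) \<longlonglongrightarrow> msqrt D"
    by (rule tendsto_msqrt[OF NA_a(1)])
  then have w_lim: "w \<longlonglongrightarrow> msqrt D *v \<pi>"
    unfolding w_def matrix_vector_mult_def by (intro tendsto_intros)
  have scaled: "\<forall>\<^sub>F n in sequentially. \<rho> n = sqrt (real n) *\<^sub>R w n \<and> \<mu> n = sqrt (real n) *\<^sub>R w n"
    using A_pd
  proof eventually_elim
    case (elim n)
    have "sqrt (real n) *\<^sub>R w n = (sqrt (real n) *\<^sub>R sqrt (1 / real n) *\<^sub>R msqrt (A n)) *v \<pi>"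
      using elim by (simp add: w_def msqrt_scaleR scaleR_matrix_vector_assoc)
    also have "\<dots> = \<mu> n"
      using elim by (simp add: \<mu>_def real_sqrt_divide)
    finally show ?case
      using elim by (simp add: \<rho>_def \<mu>_def inv_msqrt_mult(1))
  qed
  have conv: "((\<lambda>z. F (fst z) (snd z)) \<longlongrightarrow> l \<bullet> x) (sequentially \<times>\<^sub>F nhds x)" for x
  proof (rule Lim_transform_eventually)
    show "((\<lambda>z. LM1_map \<beta>\<^sub>0 \<Sigma> (transpose (row_kron_id (vector [\<beta>s, 1])) *v
          (sqrt (real (fst z)) *\<^sub>R w (fst z)) + snd z) -
        c_shift \<beta>\<^sub>0 \<Sigma> \<Delta> (sqrt (real (fst z)) *\<^sub>R w (fst z))) \<longlongrightarrow> l \<bullet> x) (sequentially \<times>\<^sub>F nhds x)"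
      unfolding l_def
      by (rule LM1_map_continuous_convergence[OF NA_c(1) w_lim _ Delta gamma_nonzero])
        (rule filterlim_compose[OF sqrt_at_top filterlim_real_sequentially])
    show "\<forall>\<^sub>F z in sequentially \<times>\<^sub>F nhds x.
        LM1_map \<beta>\<^sub>0 \<Sigma> (transpose (row_kron_id (vector [\<beta>s, 1])) *v
          (sqrt (real (fst z)) *\<^sub>R w (fst z)) + snd z) -
        c_shift \<beta>\<^sub>0 \<Sigma> \<Delta> (sqrt (real (fst z)) *\<^sub>R w (fst z)) = F (fst z) (snd z)"
      using eventually_compose_filterlim[OF scaled filterlim_fst]
      by eventually_elim (simp only: F_def)
  qed
  have "weak_conv_m (\<lambda>n. distr (distr (M n) borel (X n)) borel (F n))
      (distr (multivariate_normal 0 \<Sigma>) borel (\<lambda>x. l \<bullet> x))"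
    by (rule weak_conv_continuous_convergence_mapping[OF N _ L _ wc F_meas _ conv])
      (auto simp: multivariate_normal_def intro!: continuous_intros)
  moreover have "distr (multivariate_normal 0 \<Sigma>) borel (\<lambda>x. l \<bullet> x) =
      normal_law 0 (limit_variance \<beta>\<^sub>0 \<Sigma> D \<Delta> \<pi>)"
    using multivariate_normal_projection[OF NA_c(1) L, of l]
      limit_functional_variance[OF NA_c(1) gamma_nonzero NA_a(1)] by (simp add: l_def)
  \<comment> \<open>Holds for every \<open>n\<close>, including small ones, since
    \<open>\<rho> n\<close> and \<open>\<mu> n\<close> were kept apart in \<open>F\<close>.\<close>
  moreover have "distr (distr (M n) borel (X n)) borel (F n) = distr (M n) borel
      (\<lambda>\<omega>. LM1_stat \<beta>\<^sub>0 \<Sigma> (R_stat n (Z n) (Y n \<omega>)) -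
        c_shift \<beta>\<^sub>0 \<Sigma> \<Delta> (msqrt (crossprod n (Z n) (Z n)) *v \<pi>))" for n
  proof -
    have "LM1_stat \<beta>\<^sub>0 \<Sigma> (R_stat n (Z n) (Y n \<omega>)) -
        c_shift \<beta>\<^sub>0 \<Sigma> \<Delta> (msqrt (crossprod n (Z n) (Z n)) *v \<pi>) = F n (X n \<omega>)"
      if "\<omega> \<in> space (M n)" for \<omega>
      using vec_cols_R_stat[OF model[OF that]]
      by (simp only: LM1_stat_eq[OF NA_c(1)] F_def X_def \<rho>_def \<mu>_def A_def)
    then show ?thesis
      by (subst distr_distr[OF F_meas X_meas]) (auto intro!: distr_cong)
  qed
  ultimately show ?thesis
    by simp
qed

end
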